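(* Let $M$ be an oriented matroid on a linearly ordered finite set $E$. Then $$\bigl\{\text{reorientations } -_AM \text{ of } M,\ A\subseteq E\bigr\}=\biguplus\Bigl\{-_AM \ \Big|\ (-_AM)(F_k)/F_{k-1} \text{ is bounded w.r.t. } \min(F_k\setminus F_{k-1}) \text{ for all } 1\le k\le\iota,$$ $$\text{and } (-_AM)(F'_{k-1})/F'_k \text{ is dual-bounded w.r.t. } \min(F'_{k-1}\setminus F'_k)\text{ for all } 1\le k\le\varepsilon\Bigr\},$$ where the disjoint union is over all connected filtrations $(F'_\varepsilon,\ldots,F'_0,F_c,F_0,\ldots,F_\iota)$ of $M$. Moreover, the connected filtration of $M$ associated to a reorientation $-_AM$ by the right-hand side of this equality is the active filtration of $-_AM$.
   Context: $\subset$ denotes strict inclusion. $M(F)$ denotes the restriction of $M$ to $F$ and $M/F$ the contraction of $F$; minors inherit the order of $E$. For $A\subseteq E$, $-_AM$ is the oriented matroid obtained by reorienting $A$; reorientations of $M$ are indexed by subsets $A\subseteq E$ (so there are $2^{|E|}$ of them, and reorientations for different $A$ are distinguished even if the resulting oriented matroids are equal). Signed circuits and cocircuits come in opposite pairs; one is positive if all its signs are positive. $M$ is acyclic if it has no positive circuit, totally cyclic if it has no positive cocircuit. Bounded / dual-bounded: an oriented matroid with ground set containing $p$ is bounded with respect to $p$ if it is acyclic and every positive cocircuit contains $p$; it is dual-bounded with respect to $p$ if it is totally cyclic and every positive circuit contains $p$. Filtration of $M$: a sequence of subsets $(F'_\varepsilon,\ldots,F'_0,F_c,F_0,\ldots,F_\iota)$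 of $E$, $\iota,\varepsilon\ge0$, with $\emptyset=F'_\varepsilon\subset\cdots\subset F'_0=F_c=F_0\subset\cdots\subset F_\iota=E$, such that $\min(F_k\setminus F_{k-1})$, $1\le k\le\iota$, is increasing with $k$, and $\min(F'_{k-1}\setminus F'_k)$, $1\le k\le\varepsilon$, is increasing with $k$. It is a connected filtration of $M$ if moreover for $1\le k\le\iota$ the (underlying) matroid $M(F_k)/F_{k-1}$ is connected and is not a loop, and for $1\le k\le\varepsilon$ the matroid $M(F'_{k-1})/F'_k$ is connected and is not an isthmus ("a loop", resp. "an isthmus", means a one-element matroid whose element is a loop, resp. an isthmus; one-element matroids are connected). Activities and active filtration of an ordered oriented matroid $N$ on $E$: $O^*(N)=\{a_1<\dots<a_\iota\}$ is the set of smallest elements of positive cocircuits of $N$, and $O(N)=\{a'_1<\dots<a'_\varepsilon\}$ the set of smallest elements of positive circuits. The active filtration of $N$ is $\emptyset=F'_\varepsilon\subset\cdots\subset F'_0=F_c=F_0\subset\cdots\subset F_\iota=E$ where $F_c$ is the union of all positive circuits of $N$; $F'_k$ is the union of all positive circuits $C$ with $\min(C)\ge a'_{k+1}$, for $0\le k\le\varepsilon-1$; $F_k$ is the complement in $E$ of the union of all positive cocircuits $D$ with $\min(D)\ge a_{k+1}$, for $0\le k\le\iota-1$. *)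

theory Defs
  imports Main "HOL-Library.Disjoint_Sets"
begin

text \<open>A signed set is a pair \<open>(P, Q)\<close>: \<open>P\<close> holds the elements with sign \<open>+\<close>, and \<open>Q\<close>
  those with sign \<open>-\<close>.\<close>

type_synonym 'a signed_set = "'a set \<times> 'a set"

definition supp :: "'a signed_set \<Rightarrow> 'a set" where
  "supp X = fst X \<union> snd X"

definition opposite :: "'a signed_set \<Rightarrow> 'a signed_set" where
  "opposite X = (snd X, fst X)"

definition positive :: "'a signed_set \<Rightarrow> bool" where
  "positive X \<longleftrightarrow> snd X = {}"

definition signed_subset :: "'a signed_set \<Rightarrow> 'a set \<Rightarrow> bool" where
  "signed_subset X E \<longleftrightarrow> fst X \<inter> snd X = {} \<and> supp X \<subseteq> E"

text \<open>The first set below is where the signs of \<open>X\<close> and \<open>Y\<close> agree, the second where they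
  disagree: \<open>X\<close> and \<open>Y\<close> are orthogonal if their supports are disjoint or both sets are nonempty.\<close>

definition orthogonal :: "'a signed_set \<Rightarrow> 'a signed_set \<Rightarrow> bool" where
  "orthogonal X Y \<longleftrightarrow>
     supp X \<inter> supp Y = {} \<or>
     ((fst X \<inter> fst Y) \<union> (snd X \<inter> snd Y) \<noteq> {} \<and> (fst X \<inter> snd Y) \<union> (snd X \<inter> fst Y) \<noteq> {})"

definition sign_switch :: "'a set \<Rightarrow> 'a signed_set \<Rightarrow> 'a signed_set" where
  "sign_switch A X = ((fst X - A) \<union> (snd X \<inter> A), (snd X - A) \<union> (fst X \<inter> A))"

record 'a omatroid =
  ground :: "'a set"
  circuits :: "'a signed_set set"

text \<open>The elimination axiom is the weak one, which is equivalent to strong elimination.\<close>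

definition oriented_matroid :: "'a omatroid \<Rightarrow> bool" where
  "oriented_matroid M \<longleftrightarrow>
     finite (ground M) \<and>
     (\<forall>X \<in> circuits M. signed_subset X (ground M) \<and> supp X \<noteq> {}) \<and>
     (\<forall>X \<in> circuits M. opposite X \<in> circuits M) \<and>
     (\<forall>X \<in> circuits M. \<forall>Y \<in> circuits M. supp X \<subseteq> supp Y \<longrightarrow> X = Y \<or> X = opposite Y) \<and>
     (\<forall>X \<in> circuits M. \<forall>Y \<in> circuits M. \<forall>e. X \<noteq> opposite Y \<and> e \<in> fst X \<inter> snd Y \<longrightarrow>
        (\<exists>Z \<in> circuits M. fst Z \<subseteq> (fst X \<union> fst Y) - {e} \<and> snd Z \<subseteq> (snd X \<union> snd Y) - {e}))"

definition matroid_circuits :: "'a omatroid \<Rightarrow> 'a set set" where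
  "matroid_circuits M = supp ` circuits M"

definition independent :: "'a omatroid \<Rightarrow> 'a set \<Rightarrow> bool" where
  "independent M I \<longleftrightarrow> I \<subseteq> ground M \<and> (\<forall>C \<in> matroid_circuits M. \<not> C \<subseteq> I)"

definition matroid_bases :: "'a omatroid \<Rightarrow> 'a set set" where
  "matroid_bases M = {B. independent M B \<and> (\<forall>I. independent M I \<longrightarrow> \<not> B \<subset> I)}"

text \<open>The bases of the dual matroid are the complements of the bases.\<close>

definition codependent :: "'a omatroid \<Rightarrow> 'a set \<Rightarrow> bool" where
  "codependent M D \<longleftrightarrow> D \<subseteq> ground M \<and> (\<forall>B \<in> matroid_bases M. \<not> D \<subseteq> ground M - B)"

definition matroid_cocircuits :: "'a omatroid \<Rightarrow> 'a set set" where
  "matroid_cocircuits M = {D. codependent M D \<and> (\<forall>D'. codependent M D' \<longrightarrow> \<not> D' \<subset> D)}"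

text \<open>The signed cocircuits form the signature of the cocircuits of the underlying matroid that is
  orthogonal to the signed circuits.\<close>

definition cocircuits :: "'a omatroid \<Rightarrow> 'a signed_set set" where
  "cocircuits M = {Y. signed_subset Y (ground M) \<and> supp Y \<in> matroid_cocircuits M \<and>
                      (\<forall>X \<in> circuits M. orthogonal X Y)}"

definition reorient :: "'a set \<Rightarrow> 'a omatroid \<Rightarrow> 'a omatroid" where
  "reorient A M = \<lparr>ground = ground M, circuits = sign_switch A ` circuits M\<rparr>"

definition om_restrict :: "'a omatroid \<Rightarrow> 'a set \<Rightarrow> 'a omatroid" where
  "om_restrict M F = \<lparr>ground = ground M \<inter> F, circuits = {X \<in> circuits M. supp X \<subseteq> F}\<rparr>"

text \<open>The signed circuits of a contraction are the traces on the complement of \<open>F\<close> of the signed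
  circuits whose support is minimal among the nonempty traces.\<close>

definition traces :: "'a omatroid \<Rightarrow> 'a set \<Rightarrow> 'a signed_set set" where
  "traces M F = {X. supp X \<noteq> {} \<and> (\<exists>Z \<in> circuits M. X = (fst Z - F, snd Z - F))}"

definition om_contract :: "'a omatroid \<Rightarrow> 'a set \<Rightarrow> 'a omatroid" where
  "om_contract M F =
     \<lparr>ground = ground M - F,
      circuits = {X \<in> traces M F. \<forall>Y \<in> traces M F. \<not> supp Y \<subset> supp X}\<rparr>"

definition positive_circuits :: "'a omatroid \<Rightarrow> 'a set set" where
  "positive_circuits M = {supp X | X. X \<in> circuits M \<and> positive X}"

definition positive_cocircuits :: "'a omatroid \<Rightarrow> 'a set set" where
  "positive_cocircuits M = {supp Y | Y. Y \<in> cocircuits M \<and> positive Y}"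

definition om_acyclic :: "'a omatroid \<Rightarrow> bool" where
  "om_acyclic M \<longleftrightarrow> positive_circuits M = {}"

definition totally_cyclic :: "'a omatroid \<Rightarrow> bool" where
  "totally_cyclic M \<longleftrightarrow> positive_cocircuits M = {}"

definition bounded_wrt :: "'a omatroid \<Rightarrow> 'a \<Rightarrow> bool" where
  "bounded_wrt M p \<longleftrightarrow> p \<in> ground M \<and> om_acyclic M \<and> (\<forall>D \<in> positive_cocircuits M. p \<in> D)"

definition dual_bounded_wrt :: "'a omatroid \<Rightarrow> 'a \<Rightarrow> bool" where
  "dual_bounded_wrt M p \<longleftrightarrow> p \<in> ground M \<and> totally_cyclic M \<and> (\<forall>C \<in> positive_circuits M. p \<in> C)"

definition matroid_connected :: "'a omatroid \<Rightarrow> bool" where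
  "matroid_connected M \<longleftrightarrow>
     (\<forall>e \<in> ground M. \<forall>f \<in> ground M. e \<noteq> f \<longrightarrow> (\<exists>C \<in> matroid_circuits M. e \<in> C \<and> f \<in> C))"

definition is_loop :: "'a omatroid \<Rightarrow> bool" where
  "is_loop M \<longleftrightarrow> (\<exists>e. ground M = {e} \<and> {e} \<in> matroid_circuits M)"

definition is_isthmus :: "'a omatroid \<Rightarrow> bool" where
  "is_isthmus M \<longleftrightarrow> (\<exists>e. ground M = {e} \<and> {e} \<in> matroid_cocircuits M)"

text \<open>The sequence \<open>(F'\<^sub>\<epsilon>, \<dots>, F'\<^sub>0, F\<^sub>c, F\<^sub>0, \<dots>, F\<^sub>\<iota>)\<close> is encoded as the triple of the list
  \<open>[F'\<^sub>0, \<dots>, F'\<^sub>\<epsilon>]\<close>, the set \<open>F\<^sub>c\<close> and the list \<open>[F\<^sub>0, \<dots>, F\<^sub>\<iota>]\<close>. Beware that the primed sets are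
  listed by increasing index, hence by decreasing inclusion. Then \<open>\<epsilon>\<close> and \<open>\<iota>\<close> are the lengths
  of the two lists minus one.\<close>

type_synonym 'a filtr = "'a set list \<times> 'a set \<times> 'a set list"

definition filtration :: "'a::linorder omatroid \<Rightarrow> 'a filtr \<Rightarrow> bool" where
  "filtration M \<F> \<longleftrightarrow> (case \<F> of (F', Fc, F) \<Rightarrow>
     F' \<noteq> [] \<and> F \<noteq> [] \<and>
     F' ! (length F' - 1) = {} \<and> F' ! 0 = Fc \<and> Fc = F ! 0 \<and> F ! (length F - 1) = ground M \<and>
     (\<forall>k. 1 \<le> k \<and> k \<le> length F' - 1 \<longrightarrow> F' ! k \<subset> F' ! (k - 1)) \<and>
     (\<forall>k. 1 \<le> k \<and> k \<le> length F - 1 \<longrightarrow> F ! (k - 1) \<subset> F ! k) \<and>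
     (\<forall>k l. 1 \<le> k \<and> k < l \<and> l \<le> length F - 1 \<longrightarrow>
        Min (F ! k - F ! (k - 1)) < Min (F ! l - F ! (l - 1))) \<and>
     (\<forall>k l. 1 \<le> k \<and> k < l \<and> l \<le> length F' - 1 \<longrightarrow>
        Min (F' ! (k - 1) - F' ! k) < Min (F' ! (l - 1) - F' ! l)))"

definition connected_filtration :: "'a::linorder omatroid \<Rightarrow> 'a filtr \<Rightarrow> bool" where
  "connected_filtration M \<F> \<longleftrightarrow> filtration M \<F> \<and> (case \<F> of (F', Fc, F) \<Rightarrow>
     (\<forall>k. 1 \<le> k \<and> k \<le> length F - 1 \<longrightarrow>
        matroid_connected (om_contract (om_restrict M (F ! k)) (F ! (k - 1))) \<and>
        \<not> is_loop (om_contract (om_restrict M (F ! k)) (F ! (k - 1)))) \<and>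
     (\<forall>k. 1 \<le> k \<and> k \<le> length F' - 1 \<longrightarrow>
        matroid_connected (om_contract (om_restrict M (F' ! (k - 1))) (F' ! k)) \<and>
        \<not> is_isthmus (om_contract (om_restrict M (F' ! (k - 1))) (F' ! k))))"

definition dual_active :: "'a::linorder omatroid \<Rightarrow> 'a set" where
  "dual_active N = Min ` positive_cocircuits N"

definition active :: "'a::linorder omatroid \<Rightarrow> 'a set" where
  "active N = Min ` positive_circuits N"

text \<open>Mapping over the increasing list \<open>[a'\<^sub>1, \<dots>, a'\<^sub>\<epsilon>]\<close> yields \<open>F'\<^sub>0, \<dots>, F'\<^bsub>\<epsilon>-1\<^esub>\<close>, since
  \<open>F'\<^sub>k\<close> is defined from \<open>a'\<^bsub>k+1\<^esub>\<close>; the final set \<open>F'\<^sub>\<epsilon> = {}\<close> is appended. Similarly for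
  \<open>F\<^sub>0, \<dots>, F\<^sub>\<iota>\<close>.\<close>

definition active_filtration :: "'a::linorder omatroid \<Rightarrow> 'a filtr" where
  "active_filtration N =
     (map (\<lambda>a'. \<Union> {C \<in> positive_circuits N. a' \<le> Min C}) (sorted_list_of_set (active N)) @ [{}],
      \<Union> (positive_circuits N),
      map (\<lambda>a. ground N - \<Union> {D \<in> positive_cocircuits N. a \<le> Min D})
        (sorted_list_of_set (dual_active N)) @ [ground N])"

text \<open>Reorientations carry the subset \<open>A\<close> as an index, so that they are distinguished for different
  \<open>A\<close> even when the resulting oriented matroids are equal.\<close>

definition reorientations :: "'a omatroid \<Rightarrow> ('a set \<times> 'a omatroid) set" where
  "reorientations M = {(A, reorient A M) | A. A \<subseteq> ground M}"

definition filtration_class ::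
    "'a::linorder omatroid \<Rightarrow> 'a filtr \<Rightarrow> ('a set \<times> 'a omatroid) set" where
  "filtration_class M \<F> = {(A, N). (A, N) \<in> reorientations M \<and> (case \<F> of (F', Fc, F) \<Rightarrow>
     (\<forall>k. 1 \<le> k \<and> k \<le> length F - 1 \<longrightarrow>
        bounded_wrt (om_contract (om_restrict N (F ! k)) (F ! (k - 1)))
          (Min (F ! k - F ! (k - 1)))) \<and>
     (\<forall>k. 1 \<le> k \<and> k \<le> length F' - 1 \<longrightarrow>
        dual_bounded_wrt (om_contract (om_restrict N (F' ! (k - 1))) (F' ! k))
          (Min (F' ! (k - 1) - F' ! k))))}"

end

theory Submission
  imports Defs
begin

text \<open>Minty's painting lemma describes the positive circuits and cocircuits of a minor through
  circuits of the whole matroid whose signs are prescribed outside the contracted set. For the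
  active filtration, a positive cocircuit of \<open>M(F\<^sub>k)/F\<^bsub>k-1\<^esub>\<close> avoiding \<open>min(F\<^sub>k - F\<^bsub>k-1\<^esub>)\<close> would
  yield a positive cocircuit of the whole matroid that meets \<open>F\<^sub>k\<close> and whose smallest element lies
  beyond that minimum, whereas all such cocircuits avoid \<open>F\<^sub>k\<close>; the dual argument works for
  circuits. Bounded and dual-bounded minors are automatically connected, since otherwise a positive
  cocircuit or circuit could be found off the component of the distinguished element. Conversely,
  if the minors of a filtration are bounded and dual-bounded, a positive cocircuit that meets \<open>F\<^sub>k\<close>
  but not \<open>F\<^bsub>k-1\<^esub>\<close> has smallest element \<open>min(F\<^sub>k - F\<^bsub>k-1\<^esub>)\<close>, and the complements of the \<open>F\<^sub>k\<close> are
  unions of positive cocircuits; with the dual facts this determines the filtration.\<close>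

subsection \<open>Signed circuits\<close>

text \<open>The obstacle is that no duality is at hand. Cocircuits are defined by orthogonality to
  the signed circuits, and this alone tells neither that an unsigned cocircuit carries a signature
  nor that cocircuits can be eliminated. Signatures are obtained from rank-one contractions, so
  contraction must first be shown to preserve the axioms. With weak elimination only, this goes one
  element at a time, and conformal traces do the work of signed strong elimination. Painting then
  takes the place of duality. Signed cocircuits of minors are never lifted or restricted: they act
  only through orthogonality to circuits, which do pass between a minor and the whole. Hence the
  acyclic and the cyclic arguments are not literal mirror images. Disjointness of the classes and
  the last claim are one fact: the filtration is a function of the reoriented matroid.\<close>

lemma om_finite: "oriented_matroid M \<Longrightarrow> finite (ground M)"
  by (simp add: oriented_matroid_def)

lemma om_circuit:
  assumes "oriented_matroid M" "X \<in> circuits M"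
  shows "fst X \<inter> snd X = {}" "supp X \<subseteq> ground M" "supp X \<noteq> {}"
  using assms by (auto simp: oriented_matroid_def signed_subset_def)

lemma om_opposite: "oriented_matroid M \<Longrightarrow> X \<in> circuits M \<Longrightarrow> opposite X \<in> circuits M"
  by (simp add: oriented_matroid_def)

lemma supp_opposite [simp]: "supp (opposite X) = supp X"
  by (auto simp: supp_def opposite_def)

lemma opposite_opposite [simp]: "opposite (opposite X) = X"
  by (simp add: opposite_def)

lemma om_incomparable:
  "oriented_matroid M \<Longrightarrow> X \<in> circuits M \<Longrightarrow> Y \<in> circuits M \<Longrightarrow> supp X \<subseteq> supp Y \<Longrightarrow>
    X = Y \<or> X = opposite Y"
  by (simp add: oriented_matroid_def)

lemma om_antichain:
  "oriented_matroid M \<Longrightarrow> X \<in> circuits M \<Longrightarrow> Y \<in> circuits M \<Longrightarrow> supp X \<subseteq> supp Y \<Longrightarrow>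
    supp X = supp Y"
  using om_incomparable by fastforce

lemma om_elim:
  assumes "oriented_matroid M" "X \<in> circuits M" "Y \<in> circuits M" "X \<noteq> opposite Y"
    "e \<in> fst X" "e \<in> snd Y"
  obtains Z where "Z \<in> circuits M" "fst Z \<subseteq> fst X \<union> fst Y - {e}" "snd Z \<subseteq> snd X \<union> snd Y - {e}"
proof -
  have "\<forall>X\<in>circuits M. \<forall>Y\<in>circuits M. \<forall>e. X \<noteq> opposite Y \<and> e \<in> fst X \<inter> snd Y \<longrightarrow>
      (\<exists>Z\<in>circuits M. fst Z \<subseteq> fst X \<union> fst Y - {e} \<and> snd Z \<subseteq> snd X \<union> snd Y - {e})"
    using assms(1) unfolding oriented_matroid_def by (elim conjE)
  then show ?thesis using that assms(2-) by blast
qed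

lemma om_orient_at:
  assumes "oriented_matroid M" "X \<in> circuits M" "e \<in> supp X"
  obtains Y where "Y \<in> circuits M" "supp Y = supp X" "e \<in> fst Y"
proof (cases "e \<in> fst X")
  case False
  then have "e \<in> fst (opposite X)" using assms(3) by (simp add: supp_def opposite_def)
  then show ?thesis using that[OF om_opposite[OF assms(1,2)]] by simp
qed (use that assms(2) in blast)

text \<open>Orient both circuits positively at \<open>e\<close> and negate one of them; signed
  elimination, read on supports, then is elimination in the underlying matroid.\<close>

lemma om_elim_supp:
  assumes "oriented_matroid M" "X \<in> circuits M" "Y \<in> circuits M" "supp X \<noteq> supp Y"
    "e \<in> supp X" "e \<in> supp Y"
  obtains Z where "Z \<in> circuits M" "supp Z \<subseteq> supp X \<union> supp Y - {e}"
proof -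
  obtain X' where X': "X' \<in> circuits M" "supp X' = supp X" "e \<in> fst X'"
    using om_orient_at assms by metis
  obtain Y' where Y': "Y' \<in> circuits M" "supp Y' = supp Y" "e \<in> fst Y'"
    using om_orient_at assms by metis
  have "X' \<noteq> opposite (opposite Y')" using X' Y' assms by auto
  moreover have "e \<in> snd (opposite Y')" using Y' by (simp add: opposite_def)
  ultimately obtain Z where Z: "Z \<in> circuits M" "fst Z \<subseteq> fst X' \<union> fst (opposite Y') - {e}"
      "snd Z \<subseteq> snd X' \<union> snd (opposite Y') - {e}"
    using om_elim[OF assms(1) X'(1) om_opposite[OF assms(1) Y'(1)] _ X'(3)] by metis
  have "supp Z \<subseteq> supp X' \<union> supp Y' - {e}"
    using Z(2,3) by (auto simp: supp_def opposite_def)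
  then show ?thesis using that Z(1) X'(2) Y'(2) by metis
qed

subsection \<open>Contraction\<close>

lemma supp_trace [simp]: "supp (fst Z - F, snd Z - F) = supp Z - F"
  by (auto simp: supp_def)

lemma contract_circuitE:
  assumes "X \<in> circuits (om_contract M F)"
  obtains Z where "Z \<in> circuits M" "X = (fst Z - F, snd Z - F)" "supp X = supp Z - F" "supp X \<noteq> {}"
proof -
  from assms obtain Z where Z: "Z \<in> circuits M" "X = (fst Z - F, snd Z - F)" "supp X \<noteq> {}"
    unfolding om_contract_def traces_def select_convs by blast
  from Z(2) have "supp X = supp Z - F" by (simp only: supp_trace)
  with Z show ?thesis using that by blast
qed

lemma contract_circuit_disjoint:
  "X \<in> circuits (om_contract M F) \<Longrightarrow> supp X \<inter> F = {}"
  by (erule contract_circuitE) auto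

lemma contract_circuitI:
  assumes "Z \<in> circuits M" "supp Z - F \<noteq> {}"
    and "\<And>W. W \<in> circuits M \<Longrightarrow> supp W - F \<noteq> {} \<Longrightarrow> \<not> supp W - F \<subset> supp Z - F"
  shows "(fst Z - F, snd Z - F) \<in> circuits (om_contract M F)"
proof -
  have "(fst Z - F, snd Z - F) \<in> traces M F"
    using assms(1,2) unfolding traces_def mem_Collect_eq supp_trace by blast
  moreover have "\<not> supp Y \<subset> supp (fst Z - F, snd Z - F)" if "Y \<in> traces M F" for Y
  proof -
    obtain W where W: "supp Y \<noteq> {}" "W \<in> circuits M" "Y = (fst W - F, snd W - F)"
      using \<open>Y \<in> traces M F\<close> unfolding traces_def by blast
    then have "supp Y = supp W - F" by (simp only: supp_trace)
    then show ?thesis using assms(3)[OF W(2)] W(1) by simp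
  qed
  ultimately show ?thesis unfolding om_contract_def by simp
qed

lemma contract_circuit_minimal:
  assumes "X \<in> circuits (om_contract M F)" "W \<in> circuits M" "supp W - F \<noteq> {}"
  shows "\<not> supp W - F \<subset> supp X"
proof -
  have "(fst W - F, snd W - F) \<in> traces M F"
    using assms(2,3) unfolding traces_def mem_Collect_eq supp_trace by blast
  with assms(1) have "\<not> supp (fst W - F, snd W - F) \<subset> supp X"
    unfolding om_contract_def by fastforce
  then show ?thesis unfolding supp_trace .
qed

text \<open>Since \<open>g\<close> lies on \<open>Z\<close>, a smaller trace would come from a
  circuit with support inside that of \<open>Z\<close>, against incomparability. Only circuits
  avoiding \<open>g\<close> can have traces that are not minimal.\<close>

lemma trace_single_minimal:
  assumes M: "oriented_matroid M" and Z: "Z \<in> circuits M" "g \<in> supp Z" "supp Z \<noteq> {g}"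
  shows "(fst Z - {g}, snd Z - {g}) \<in> circuits (om_contract M {g})"
proof (rule contract_circuitI[OF Z(1)])
  show "supp Z - {g} \<noteq> {}" using Z by auto
  fix W assume W: "W \<in> circuits M" "supp W - {g} \<noteq> {}"
  show "\<not> supp W - {g} \<subset> supp Z - {g}"
  proof
    assume less: "supp W - {g} \<subset> supp Z - {g}"
    then have "supp W \<subseteq> supp Z" using Z(2) by auto
    then have "supp W = supp Z" using om_antichain[OF M W(1) Z(1)] by simp
    with less show False by simp
  qed
qed

text \<open>Induction on the number of elements where \<open>Q\<close> and \<open>V\<close>
  disagree. Eliminating one of them between \<open>Q\<close> and \<open>V\<close> creates no new
  disagreement. The result still contains \<open>g\<close>, as otherwise it would be a circuit
  properly inside \<open>V\<close>, and since \<open>V\<close> avoids \<open>g\<close>, it has the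
  sign of \<open>Q\<close> there.\<close>

lemma circuit_through_conformal:
  assumes M: "oriented_matroid M" and V: "V \<in> circuits M" "g \<notin> supp V"
    and Q: "Q \<in> circuits M" "g \<in> supp Q" "supp Q \<noteq> {g}" "supp Q - {g} \<subseteq> supp V"
  shows "\<exists>Q'\<in>circuits M. (g \<in> fst Q' \<longleftrightarrow> g \<in> fst Q) \<and> (g \<in> snd Q' \<longleftrightarrow> g \<in> snd Q) \<and>
    supp Q' \<noteq> {g} \<and> fst Q' - {g} \<subseteq> fst V \<and> snd Q' - {g} \<subseteq> snd V"
  using Q
proof (induction "card (fst Q \<inter> snd V \<union> snd Q \<inter> fst V)" arbitrary: Q rule: less_induct)
  case less
  let ?d = "\<lambda>Q. fst Q \<inter> snd V \<union> snd Q \<inter> fst V"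
  note VQ = om_circuit[OF M V(1)] om_circuit[OF M less.prems(1)]
  have fin: "finite (?d Q)"
    by (rule finite_subset[OF _ om_finite[OF M]]) (use VQ(2) in \<open>auto simp: supp_def\<close>)
  show ?case
  proof (cases "?d Q = {}")
    case True
    then have "fst Q - {g} \<subseteq> fst V" "snd Q - {g} \<subseteq> snd V"
      using less.prems(4) by (auto simp: supp_def)
    then show ?thesis using less.prems by blast
  next
    case False
    then obtain h where h: "h \<in> ?d Q" by auto
    have ne: "Q \<noteq> opposite V" using less.prems(2) V(2) by auto
    have "\<exists>Z\<in>circuits M. fst Z \<subseteq> fst Q \<union> fst V - {h} \<and> snd Z \<subseteq> snd Q \<union> snd V - {h}"
    proof (cases "h \<in> fst Q")
      case True
      then have "h \<in> snd V" using h VQ by auto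
      from om_elim[OF M less.prems(1) V(1) ne True this] show ?thesis by metis
    next
      case False
      have neg: "V \<noteq> opposite Q" using ne by auto
      have "h \<in> fst V" "h \<in> snd Q" using False h by auto
      from om_elim[OF M V(1) less.prems(1) neg this] show ?thesis by (metis Un_commute)
    qed
    then obtain Z where Z: "Z \<in> circuits M" "fst Z \<subseteq> fst Q \<union> fst V - {h}"
        "snd Z \<subseteq> snd Q \<union> snd V - {h}" by blast
    have hV: "h \<in> supp V" using h by (auto simp: supp_def)
    have ZV: "supp Z \<subseteq> insert g (supp V) - {h}"
      using Z less.prems(4) by (auto simp: supp_def)
    have gZ: "g \<in> supp Z"
    proof (rule ccontr)
      assume "g \<notin> supp Z"
      then have "supp Z \<subseteq> supp V" using ZV by auto
      then have "supp Z = supp V" using om_antichain[OF M Z(1) V(1)] by simp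
      then show False using ZV hV by auto
    qed
    have Zg: "supp Z \<noteq> {g}"
    proof
      assume "supp Z = {g}"
      moreover from this have "supp Z = supp Q"
        using om_antichain[OF M Z(1) less.prems(1)] less.prems(2) by simp
      ultimately show False using less.prems(3) by simp
    qed
    have d: "?d Z \<subseteq> ?d Q - {h}" using Z(2,3) VQ(1) by blast
    then have "?d Z \<subset> ?d Q" using h by blast
    then have "card (?d Z) < card (?d Q)" by (rule psubset_card_mono[OF fin])
    from less.hyps[OF this Z(1) gZ Zg] ZV
    obtain Q' where Q': "Q' \<in> circuits M" "(g \<in> fst Q') = (g \<in> fst Z)"
        "(g \<in> snd Q') = (g \<in> snd Z)" "supp Q' \<noteq> {g}" "fst Q' - {g} \<subseteq> fst V"
        "snd Q' - {g} \<subseteq> snd V" by blast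
    have "(g \<in> fst Z) = (g \<in> fst Q)" "(g \<in> snd Z) = (g \<in> snd Q)"
      using gZ Z(2,3) V(2) VQ(4) less.prems(2) unfolding supp_def by blast+
    with Q' show ?thesis by auto
  qed
qed

text \<open>A circuit \<open>V\<close> avoiding \<open>g\<close> whose trace is not minimal is the conformal composition of two
  circuits through \<open>g\<close> with opposite signs at \<open>g\<close>, because eliminating \<open>g\<close> between them gives
  back \<open>V\<close>.\<close>

lemma trace_single_conformal:
  assumes M: "oriented_matroid M" and V: "V \<in> circuits M" "x \<in> supp V - {g}"
  shows "\<exists>X\<in>circuits (om_contract M {g}). x \<in> supp X \<and> fst X \<subseteq> fst V \<and> snd X \<subseteq> snd V"
proof (cases "g \<in> supp V")
  case True
  then have "(fst V - {g}, snd V - {g}) \<in> circuits (om_contract M {g})"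
    using trace_single_minimal[OF M V(1)] V(2) by auto
  then show ?thesis using V by (force simp: supp_def)
next
  case g: False
  show ?thesis
  proof (cases "(fst V - {g}, snd V - {g}) \<in> circuits (om_contract M {g})")
    case True
    then show ?thesis using V by (force simp: supp_def)
  next
    case False
    then obtain W where W: "W \<in> circuits M" "supp W - {g} \<noteq> {}" "supp W - {g} \<subset> supp V - {g}"
      using contract_circuitI[OF V(1), of "{g}"] V(2) by blast
    have gW: "g \<in> supp W"
    proof (rule ccontr)
      assume "g \<notin> supp W"
      then have "supp W \<subset> supp V" using W(3) g by auto
      then show False using om_antichain[OF M W(1) V(1)] by auto
    qed
    have Wg: "supp W \<noteq> {g}" "supp W - {g} \<subseteq> supp V" using W by auto
    obtain W1 where W1: "W1 \<in> circuits M" "supp W1 = supp W" "g \<in> fst W1"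
      using om_orient_at[OF M W(1) gW] .
    have W2: "opposite W1 \<in> circuits M" using om_opposite[OF M W1(1)] .
    obtain Q where Q: "Q \<in> circuits M" "g \<in> fst Q" "supp Q \<noteq> {g}" "fst Q - {g} \<subseteq> fst V"
        "snd Q - {g} \<subseteq> snd V"
      using circuit_through_conformal[OF M V(1) g W1(1)] W1 Wg gW by auto
    have "g \<in> snd (opposite W1)" using W1 by (simp add: opposite_def)
    then obtain R where R: "R \<in> circuits M" "g \<in> snd R" "supp R \<noteq> {g}" "fst R - {g} \<subseteq> fst V"
        "snd R - {g} \<subseteq> snd V"
      using circuit_through_conformal[OF M V(1) g W2] W1 Wg gW by auto
    have disj: "fst V \<inter> snd V = {}" using om_circuit[OF M V(1)] by simp
    have "Q \<noteq> opposite R"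
    proof
      assume QR: "Q = opposite R"
      obtain h where h: "h \<in> supp Q" "h \<noteq> g" using Q(2,3) by (auto simp: supp_def)
      then have "h \<in> fst V" "h \<in> snd V" 
        using Q(4,5) R(4,5) QR by (auto simp: supp_def opposite_def)
      then show False using disj by blast
    qed
    then obtain U where U: "U \<in> circuits M" "fst U \<subseteq> fst Q \<union> fst R - {g}"
        "snd U \<subseteq> snd Q \<union> snd R - {g}"
      using om_elim[OF M Q(1) R(1)] Q(2) R(2) by metis
    then have "supp U \<subseteq> supp V" using Q R by (auto simp: supp_def)
    then have "supp U = supp V" using om_antichain[OF M U(1) V(1)] by simp
    then have "x \<in> supp Q \<or> x \<in> supp R" using V(2) U(2,3) by (auto simp: supp_def)
    then obtain S where S: "S \<in> circuits M" "g \<in> supp S" "supp S \<noteq> {g}" "fst S - {g} \<subseteq> fst V"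
        "snd S - {g} \<subseteq> snd V" "x \<in> supp S"
      using Q R by (metis UnI1 UnI2 supp_def)
    show ?thesis
    proof (rule bexI[OF _ trace_single_minimal[OF M S(1-3)]])
      show "x \<in> supp (fst S - {g}, snd S - {g}) \<and> fst (fst S - {g}, snd S - {g}) \<subseteq> fst V \<and>
          snd (fst S - {g}, snd S - {g}) \<subseteq> snd V"
        using S V(2) by (auto simp: supp_def)
    qed
  qed
qed

lemma om_contract_single:
  assumes M: "oriented_matroid M"
  shows "oriented_matroid (om_contract M {g})"
  unfolding oriented_matroid_def
proof (intro conjI ballI allI impI)
  let ?P = "om_contract M {g}"
  show "finite (ground ?P)" using om_finite[OF M] by (simp add: om_contract_def)
  fix X assume X: "X \<in> circuits ?P"
  obtain Z where Z: "Z \<in> circuits M" "X = (fst Z - {g}, snd Z - {g})" "supp X = supp Z - {g}"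
      "supp X \<noteq> {}"
    using contract_circuitE[OF X] .
  show "supp X \<noteq> {}" by fact
  show "signed_subset X (ground ?P)"
    using om_circuit[OF M Z(1)] Z(2,3) by (auto simp: signed_subset_def om_contract_def)
  show "opposite X \<in> circuits ?P"
  proof -
    have "opposite Z \<in> circuits M" using om_opposite[OF M Z(1)] .
    moreover have "opposite X = (fst (opposite Z) - {g}, snd (opposite Z) - {g})"
      by (simp add: opposite_def Z(2))
    ultimately show ?thesis
      using contract_circuitI[of "opposite Z" M "{g}"] contract_circuit_minimal[OF X] Z by auto
  qed
  fix Y assume Y: "Y \<in> circuits ?P"
  obtain W where W: "W \<in> circuits M" "Y = (fst W - {g}, snd W - {g})" "supp Y = supp W - {g}"
      "supp Y \<noteq> {}"
    using contract_circuitE[OF Y] .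
  show "X = Y \<or> X = opposite Y" if XY: "supp X \<subseteq> supp Y"
  proof (rule ccontr)
    assume neq: "\<not> (X = Y \<or> X = opposite Y)"
    then have ZW: "Z \<noteq> W" "Z \<noteq> opposite W" using Z(2) W(2) by (auto simp: opposite_def)
    have eq: "supp X = supp Y"
      using contract_circuit_minimal[OF Y Z(1)] Z XY by auto
    have ns: "supp Z \<noteq> supp W" using om_incomparable[OF M Z(1) W(1)] ZW by auto
    \<comment> \<open>Equal traces of distinct supports differ exactly in \<open>g\<close>, so one
      support contains the other.\<close>
    then have "g \<in> supp Z \<longleftrightarrow> g \<notin> supp W" using eq Z(3) W(3) by blast
    then have "supp Z \<subseteq> supp W \<or> supp W \<subseteq> supp Z" using eq Z(3) W(3) by auto
    then show False using om_antichain[OF M] Z(1) W(1) ns by blast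
  qed
  fix e assume e: "X \<noteq> opposite Y \<and> e \<in> fst X \<inter> snd Y"
  then have "Z \<noteq> opposite W" "e \<in> fst Z" "e \<in> snd W" using Z(2) W(2) by (auto simp: opposite_def)
  then obtain V where V: "V \<in> circuits M" "fst V \<subseteq> fst Z \<union> fst W - {e}"
      "snd V \<subseteq> snd Z \<union> snd W - {e}"
    using om_elim[OF M Z(1) W(1)] by metis
  \<comment> \<open>Elimination takes place before contracting. The trace of \<open>V\<close> must
    be nonempty to contain a conformal circuit of the contraction; if \<open>V\<close> were the loop
    \<open>g\<close>, it would lie inside \<open>Z\<close> or \<open>W\<close>.\<close>
  have "supp V \<noteq> {g}"
  proof
    assume Vg: "supp V = {g}"
    then have "g \<in> supp Z \<or> g \<in> supp W" using V by (auto simp: supp_def)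
    then show False
      using om_antichain[OF M V(1) Z(1)] om_antichain[OF M V(1) W(1)] Vg Z(3,4) W(3,4) by auto
  qed
  then obtain x where "x \<in> supp V - {g}" using om_circuit(3)[OF M V(1)] by auto
  then obtain U where U: "U \<in> circuits ?P" "fst U \<subseteq> fst V" "snd U \<subseteq> snd V"
    using trace_single_conformal[OF M V(1)] by metis
  have "g \<notin> supp U" using contract_circuit_disjoint[OF U(1)] by auto
  then have "fst U \<subseteq> fst X \<union> fst Y - {e} \<and> snd U \<subseteq> snd X \<union> snd Y - {e}"
    using U V Z(2) W(2) by (auto simp: supp_def)
  then show "\<exists>Z\<in>circuits ?P. fst Z \<subseteq> fst X \<union> fst Y - {e} \<and> snd Z \<subseteq> snd X \<union> snd Y - {e}"
    using U(1) by blast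
qed

lemma om_contract_empty:
  assumes M: "oriented_matroid M"
  shows "om_contract M {} = M"
proof -
  have "traces M {} = circuits M"
    using om_circuit[OF M] by (auto simp: traces_def supp_def)
  moreover have "\<not> supp Y \<subset> supp X" if "X \<in> circuits M" "Y \<in> circuits M" for X Y
    using om_antichain[OF M] that by blast
  ultimately have "{X \<in> traces M {}. \<forall>Y\<in>traces M {}. \<not> supp Y \<subset> supp X} = circuits M"
    by blast
  then show ?thesis by (simp add: om_contract_def)
qed

text \<open>Contracting in two steps discards some traces early, so the trace sets \<open>?T\<close>
  and \<open>?S\<close> differ. They have the same minimal members because every trace in
  \<open>?S\<close> contains one in \<open>?T\<close> conformally; equal supports then force equal
  signs.\<close>

lemma om_contract_insert:
  assumes M: "oriented_matroid M"
  shows "om_contract (om_contract M {g}) F = om_contract M (insert g F)"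
proof -
  let ?S = "traces M (insert g F)" and ?T = "traces (om_contract M {g}) F"
  have TS: "?T \<subseteq> ?S"
  proof
    fix X assume "X \<in> ?T"
    then obtain W where W: "W \<in> circuits (om_contract M {g})" "X = (fst W - F, snd W - F)"
        "supp X \<noteq> {}"
      unfolding traces_def by blast
    obtain Z where "Z \<in> circuits M" "W = (fst Z - {g}, snd Z - {g})"
      using contract_circuitE[OF W(1)] .
    with W show "X \<in> ?S" by (auto simp: traces_def intro!: bexI[of _ Z])
  qed
  have conf: "\<exists>Y\<in>?T. fst Y \<subseteq> fst X \<and> snd Y \<subseteq> snd X" and disj: "fst X \<inter> snd X = {}"
    if "X \<in> ?S" for X
  proof -
    obtain Z where Z: "Z \<in> circuits M" "X = (fst Z - insert g F, snd Z - insert g F)"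
        "supp X \<noteq> {}"
      using \<open>X \<in> ?S\<close> unfolding traces_def by blast
    then obtain x where x: "x \<in> supp Z - {g}" "x \<notin> F" by (auto simp: supp_def)
    obtain W where W: "W \<in> circuits (om_contract M {g})" "x \<in> supp W" "fst W \<subseteq> fst Z"
        "snd W \<subseteq> snd Z"
      using trace_single_conformal[OF M Z(1) x(1)] by blast
    have gW: "g \<notin> supp W" using contract_circuit_disjoint[OF W(1)] by auto
    have "(fst W - F, snd W - F) \<in> ?T"
      using W x by (auto simp: traces_def supp_def)
    then show "\<exists>Y\<in>?T. fst Y \<subseteq> fst X \<and> snd Y \<subseteq> snd X"
      using W Z(2) gW by (intro bexI) (auto simp: supp_def)
    show "fst X \<inter> snd X = {}" using om_circuit(1)[OF M Z(1)] Z(2) by auto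
  qed
  have "{X \<in> ?T. \<forall>Y\<in>?T. \<not> supp Y \<subset> supp X} = {X \<in> ?S. \<forall>Y\<in>?S. \<not> supp Y \<subset> supp X}"
  proof (intro set_eqI, unfold mem_Collect_eq, intro iffI conjI ballI; elim conjE)
    fix X assume X: "X \<in> ?T" "\<forall>Y\<in>?T. \<not> supp Y \<subset> supp X"
    show "X \<in> ?S" using X(1) TS by auto
    fix Y assume Y: "Y \<in> ?S"
    from conf[OF this] obtain Y' where "Y' \<in> ?T" "supp Y' \<subseteq> supp Y" by (auto simp: supp_def)
    then show "\<not> supp Y \<subset> supp X" using X(2) by blast
  next
    fix X assume X: "X \<in> ?S" "\<forall>Y\<in>?S. \<not> supp Y \<subset> supp X"
    from conf[OF X(1)] obtain Y where Y: "Y \<in> ?T" "fst Y \<subseteq> fst X" "snd Y \<subseteq> snd X" by auto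
    then have "supp Y = supp X" using X(2) TS by (auto simp: supp_def)
    then have "fst Y = fst X" "snd Y = snd X" using Y disj[OF X(1)] by (auto simp: supp_def)
    then show "X \<in> ?T" using Y(1) by (metis prod_eq_iff)
  next
    fix X Y assume "\<forall>Y\<in>?S. \<not> supp Y \<subset> supp X" "Y \<in> ?T"
    then show "\<not> supp Y \<subset> supp X" using TS by blast
  qed
  moreover have "ground (om_contract M {g}) - F = ground M - insert g F"
    by (auto simp: om_contract_def)
  ultimately show ?thesis unfolding om_contract_def[of _ F] om_contract_def[of _ "insert g F"]
    by simp
qed

lemma om_contract:
  assumes "oriented_matroid M" "finite F"
  shows "oriented_matroid (om_contract M F)"
  using assms(2,1)
proof (induction F arbitrary: M rule: finite_induct)
  case empty
  then show ?case by (simp add: om_contract_empty)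
next
  case (insert g F)
  then show ?case by (metis om_contract_insert om_contract_single)
qed

lemma trace_conformal:
  assumes "oriented_matroid M" "finite F" "V \<in> circuits M" "x \<in> supp V - F"
  shows "\<exists>X\<in>circuits (om_contract M F). x \<in> supp X \<and> fst X \<subseteq> fst V \<and> snd X \<subseteq> snd V"
  using assms(2,1,3,4)
proof (induction F arbitrary: M V rule: finite_induct)
  case empty
  then show ?case by (auto simp: om_contract_empty)
next
  case (insert g F)
  obtain W where W: "W \<in> circuits (om_contract M {g})" "x \<in> supp W" "fst W \<subseteq> fst V"
      "snd W \<subseteq> snd V"
    using trace_single_conformal[OF insert.prems(1,2)] insert.prems(3) by blast
  then obtain X where "X \<in> circuits (om_contract (om_contract M {g}) F)" "x \<in> supp X"
      "fst X \<subseteq> fst W" "snd X \<subseteq> snd W"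
    using insert.IH[OF om_contract_single[OF insert.prems(1)] W(1)] insert.prems(3) by blast
  then show ?case
    using W unfolding om_contract_insert[OF insert.prems(1)] by (meson order_trans)
qed

subsection \<open>Closure and the underlying matroid\<close>

lemma matroid_circuits_iff: "C \<in> matroid_circuits M \<longleftrightarrow> (\<exists>X\<in>circuits M. supp X = C)"
  by (auto simp: matroid_circuits_def)

lemma matroid_circuit_subset:
  "oriented_matroid M \<Longrightarrow> C \<in> matroid_circuits M \<Longrightarrow> C \<subseteq> ground M"
  using om_circuit(2) by (metis matroid_circuits_iff)

lemma matroid_circuit_antichain:
  "oriented_matroid M \<Longrightarrow> C \<in> matroid_circuits M \<Longrightarrow> C' \<in> matroid_circuits M \<Longrightarrow> C \<subseteq> C' \<Longrightarrow> C = C'"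
  using om_antichain by (metis matroid_circuits_iff)

lemma matroid_elim:
  assumes "oriented_matroid M" "C \<in> matroid_circuits M" "C' \<in> matroid_circuits M" "C \<noteq> C'"
    "e \<in> C" "e \<in> C'"
  obtains D where "D \<in> matroid_circuits M" "D \<subseteq> C \<union> C' - {e}"
  using assms om_elim_supp[OF assms(1)] unfolding matroid_circuits_iff by metis

text \<open>If weak elimination of \<open>y\<close> loses \<open>x\<close>, it gives
  \<open>C3\<close>, which contains some \<open>z\<close> of \<open>C\<close> outside
  \<open>C'\<close>. Eliminating \<open>z\<close> between \<open>C3\<close> and \<open>C\<close>
  while keeping \<open>y\<close> gives \<open>C4\<close>, and eliminating \<open>y\<close> between
  \<open>C4\<close> and \<open>C'\<close> keeps \<open>x\<close>. The first union misses
  \<open>x\<close> and the second misses \<open>z\<close>, so induction on the size of the union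
  applies to both.\<close>

lemma matroid_strong_elim:
  assumes M: "oriented_matroid M"
    and "C \<in> matroid_circuits M" "C' \<in> matroid_circuits M" "y \<in> C" "y \<in> C'" "x \<in> C'" "x \<notin> C"
  shows "\<exists>D\<in>matroid_circuits M. x \<in> D \<and> D \<subseteq> C \<union> C' - {y}"
  using assms(2-)
proof (induction "card (C \<union> C')" arbitrary: C C' x y rule: less_induct)
  case less
  note C = less.prems(1) and C' = less.prems(2)
  have fin: "finite (C \<union> C')"
    using matroid_circuit_subset[OF M C] matroid_circuit_subset[OF M C'] om_finite[OF M]
    by (meson Un_least finite_subset)
  show ?case
  proof (rule ccontr)
    assume no: "\<not> ?thesis"
    have "C \<noteq> C'" using less.prems(5,6) by blast
    then obtain C3 where C3: "C3 \<in> matroid_circuits M" "C3 \<subseteq> C \<union> C' - {y}"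
      using matroid_elim[OF M C C' _ less.prems(3,4)] by metis
    then have x3: "x \<notin> C3" using no by blast
    have "\<not> C3 \<subseteq> C'" using matroid_circuit_antichain[OF M C3(1) C'] C3(2) less.prems(4) by blast
    then obtain z where z: "z \<in> C3" "z \<notin> C'" "z \<in> C" using C3(2) by blast
    have "C3 \<union> C \<subset> C \<union> C'" using C3(2) x3 less.prems(5,6) by blast
    then have "card (C3 \<union> C) < card (C \<union> C')" by (rule psubset_card_mono[OF fin])
    from less.hyps[OF this C3(1) C z(1,3) less.prems(3)] C3(2)
    obtain C4 where C4: "C4 \<in> matroid_circuits M" "y \<in> C4" "C4 \<subseteq> C3 \<union> C - {z}" by blast
    have x4: "x \<notin> C4" using C4(3) x3 less.prems(6) by blast
    have "z \<in> C \<union> C'" "C4 \<union> C' \<subseteq> C \<union> C' - {z}" using C4(3) C3(2) z by blast+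
    then have "C4 \<union> C' \<subset> C \<union> C'" by blast
    then have "card (C4 \<union> C') < card (C \<union> C')" by (rule psubset_card_mono[OF fin])
    from less.hyps[OF this C4(1) C' C4(2) less.prems(4,5) x4]
    obtain C5 where C5: "C5 \<in> matroid_circuits M" "x \<in> C5" "C5 \<subseteq> C4 \<union> C' - {y}" by blast
    have "C5 \<subseteq> C \<union> C' - {y}" using C5(3) C4(3) C3(2) by blast
    then show False using no C5 by blast
  qed
qed

text \<open>For a common element \<open>y\<close>, strong elimination gives \<open>A\<close> through
  \<open>x\<close> and \<open>B\<close> through \<open>z\<close>, both avoiding \<open>y\<close>. If
  \<open>B\<close> contains \<open>C' - C\<close>, then it meets \<open>A\<close>, and the two miss
  \<open>y\<close>; otherwise \<open>C\<close> and \<open>B\<close> meet and miss a point of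
  \<open>C' - C\<close>. Either pair has a smaller union.\<close>

lemma matroid_common_circuit_trans:
  assumes M: "oriented_matroid M"
    and "C \<in> matroid_circuits M" "C' \<in> matroid_circuits M" "x \<in> C" "z \<in> C'" "C \<inter> C' \<noteq> {}"
  shows "\<exists>D\<in>matroid_circuits M. x \<in> D \<and> z \<in> D"
  using assms(2-)
proof (induction "card (C \<union> C')" arbitrary: C C' rule: less_induct)
  case less
  note C = less.prems(1) and C' = less.prems(2)
  have fin: "finite (C \<union> C')"
    using matroid_circuit_subset[OF M C] matroid_circuit_subset[OF M C'] om_finite[OF M]
    by (meson Un_least finite_subset)
  have IH: "\<exists>D\<in>matroid_circuits M. x \<in> D \<and> z \<in> D"
    if "A \<in> matroid_circuits M" "B \<in> matroid_circuits M" "x \<in> A" "z \<in> B" "A \<inter> B \<noteq> {}"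
      "A \<union> B \<subset> C \<union> C'" for A B
    using less.hyps[OF psubset_card_mono[OF fin that(6)]] that(1-5) by blast
  show ?case
  proof (cases "x \<in> C' \<or> z \<in> C")
    case True
    then show ?thesis using less.prems by blast
  next
    case False
    obtain y where y: "y \<in> C" "y \<in> C'" using less.prems(5) by blast
    obtain A where A: "A \<in> matroid_circuits M" "x \<in> A" "A \<subseteq> C \<union> C' - {y}"
      using matroid_strong_elim[OF M C' C y(2,1) less.prems(3)] False by blast
    obtain B where B: "B \<in> matroid_circuits M" "z \<in> B" "B \<subseteq> C \<union> C' - {y}"
      using matroid_strong_elim[OF M C C' y less.prems(4)] False by blast
    have "\<not> A \<subseteq> C" using matroid_circuit_antichain[OF M A(1) C] A(3) y by blast
    then have AC: "A \<inter> (C' - C) \<noteq> {}" using A(3) by blast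
    have "\<not> B \<subseteq> C'" using matroid_circuit_antichain[OF M B(1) C'] B(3) y by blast
    then have BC: "B \<inter> (C - C') \<noteq> {}" using B(3) by blast
    show ?thesis
    proof (cases "C' - C \<subseteq> B")
      case True
      show ?thesis
      proof (rule IH[OF A(1) B(1) A(2) B(2)])
        show "A \<inter> B \<noteq> {}" using True AC by blast
        show "A \<union> B \<subset> C \<union> C'" using A(3) B(3) y by blast
      qed
    next
      case ne: False
      show ?thesis
      proof (rule IH[OF C B(1) less.prems(3) B(2)])
        show "C \<inter> B \<noteq> {}" using BC by blast
        show "C \<union> B \<subset> C \<union> C'" using ne B(3) by blast
      qed
    qed
  qed
qed

section \<open>Closure, bases and complements of cocircuits, without a rank function\<close>

definition closure_in :: "'a omatroid \<Rightarrow> 'a set \<Rightarrow> 'a set" where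
  "closure_in M A = A \<union> {x. \<exists>C\<in>matroid_circuits M. x \<in> C \<and> C \<subseteq> insert x A}"

lemma closure_in_mono: "A \<subseteq> B \<Longrightarrow> closure_in M A \<subseteq> closure_in M B"
  unfolding closure_in_def by blast

lemma closure_in_superset: "A \<subseteq> closure_in M A"
  unfolding closure_in_def by blast

lemma closure_in_subset:
  assumes "oriented_matroid M" "A \<subseteq> ground M" shows "closure_in M A \<subseteq> ground M"
  using assms matroid_circuit_subset[OF assms(1)] unfolding closure_in_def by blast

text \<open>Idempotence for one added element: strong elimination of \<open>y\<close> between a
  circuit that puts \<open>y\<close> in the closure and one that puts \<open>x\<close>
  there.\<close>

lemma closure_in_absorb:
  assumes M: "oriented_matroid M" and y: "y \<in> closure_in M A" and x: "x \<in> closure_in M (insert y A)"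
  shows "x \<in> closure_in M A"
proof (cases "x \<in> insert y A")
  case True
  then show ?thesis using y closure_in_superset[of A M] by blast
next
  case xA: False
  then obtain C' where C': "C' \<in> matroid_circuits M" "x \<in> C'" "C' \<subseteq> insert x (insert y A)"
    using x unfolding closure_in_def by blast
  show ?thesis
  proof (cases "y \<in> C' \<and> y \<notin> A")
    case True
    then obtain C where C: "C \<in> matroid_circuits M" "y \<in> C" "C \<subseteq> insert y A"
      using y unfolding closure_in_def by blast
    have "x \<notin> C" using C(3) xA by blast
    then obtain D where "D \<in> matroid_circuits M" "x \<in> D" "D \<subseteq> C \<union> C' - {y}"
      using matroid_strong_elim[OF M C(1) C'(1) C(2) _ C'(2)] True by blast
    then show ?thesis using C(3) C'(3) unfolding closure_in_def by blast
  next
    case False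
    then show ?thesis using C' unfolding closure_in_def by blast
  qed
qed

lemma closure_in_Un:
  assumes M: "oriented_matroid M" and "finite B" "B \<subseteq> closure_in M A"
  shows "closure_in M (A \<union> B) \<subseteq> closure_in M A"
  using assms(2,3)
proof (induction B rule: finite_induct)
  case (insert b B)
  have "b \<in> closure_in M (A \<union> B)" using insert.prems closure_in_mono[of A "A \<union> B" M] by auto
  then have "closure_in M (insert b (A \<union> B)) \<subseteq> closure_in M (A \<union> B)"
    using closure_in_absorb[OF M] by blast
  then show ?case using insert by auto
qed simp

lemma closure_in_closure:
  assumes M: "oriented_matroid M" and "A \<subseteq> ground M" "B \<subseteq> closure_in M A"
  shows "closure_in M B \<subseteq> closure_in M A"
proof -
  have "finite B" using assms closure_in_subset[OF M] om_finite[OF M] by (meson finite_subset)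
  then show ?thesis using closure_in_Un[OF M _ assms(3)] closure_in_mono[of B "A \<union> B" M] by blast
qed

lemma base_iff:
  assumes M: "oriented_matroid M"
  shows "B \<in> matroid_bases M \<longleftrightarrow> independent M B \<and> closure_in M B = ground M"
proof (intro iffI conjI)
  assume B: "B \<in> matroid_bases M"
  then show ind: "independent M B" by (simp add: matroid_bases_def)
  then have BE: "B \<subseteq> ground M" by (simp add: independent_def)
  have "x \<in> closure_in M B" if x: "x \<in> ground M" "x \<notin> B" for x
  proof -
    have "\<not> independent M (insert x B)" using B x(2) unfolding matroid_bases_def by blast
    then obtain C where "C \<in> matroid_circuits M" "C \<subseteq> insert x B"
      using BE x(1) unfolding independent_def by blast
    moreover from this have "x \<in> C" using ind unfolding independent_def by blast
    ultimately show ?thesis unfolding closure_in_def by blast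
  qed
  then show "closure_in M B = ground M"
    using closure_in_subset[OF M BE] closure_in_superset[of B M] by blast
next
  assume B: "independent M B \<and> closure_in M B = ground M"
  have "\<not> B \<subset> I" if I: "independent M I" for I
  proof
    assume "B \<subset> I"
    then obtain x where x: "x \<in> I" "x \<notin> B" by blast
    then have "x \<in> closure_in M B" using B I unfolding independent_def by blast
    then obtain C where "C \<in> matroid_circuits M" "C \<subseteq> insert x B"
      using x(2) unfolding closure_in_def by blast
    then show False using I x(1) \<open>B \<subset> I\<close> unfolding independent_def by blast
  qed
  then show "B \<in> matroid_bases M" using B unfolding matroid_bases_def by blast
qed

text \<open>A maximal independent subset of \<open>A\<close> has all of \<open>A\<close> in its
  closure, so it spans as soon as \<open>A\<close> does. This turns codependence, which is defined
  by bases, into a statement about closures.\<close>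

lemma spanning_iff_base:
  assumes M: "oriented_matroid M" and A: "A \<subseteq> ground M"
  shows "closure_in M A = ground M \<longleftrightarrow> (\<exists>B\<in>matroid_bases M. B \<subseteq> A)"
proof
  assume span: "closure_in M A = ground M"
  let ?I = "{I. I \<subseteq> A \<and> independent M I}"
  have "finite ?I" using A om_finite[OF M] by (auto intro: finite_subset[of _ "Pow A"] finite_subset)
  moreover have "{} \<in> ?I"
    using om_circuit(3)[OF M] unfolding independent_def matroid_circuits_def by auto
  ultimately obtain I where I: "I \<in> ?I" "\<forall>J\<in>?I. I \<subseteq> J \<longrightarrow> I = J"
    using finite_has_maximal[of ?I] by blast
  have "x \<in> closure_in M I" if x: "x \<in> A" "x \<notin> I" for x
  proof -
    have "\<not> independent M (insert x I)" using I x by blast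
    then obtain C where "C \<in> matroid_circuits M" "C \<subseteq> insert x I"
      using I(1) A x(1) unfolding independent_def by blast
    moreover from this have "x \<in> C" using I(1) unfolding independent_def by blast
    ultimately show ?thesis unfolding closure_in_def by blast
  qed
  then have AI: "A \<subseteq> closure_in M I" using closure_in_superset[of I M] by blast
  have IE: "I \<subseteq> ground M" using I(1) A by blast
  have "closure_in M A \<subseteq> closure_in M I" by (rule closure_in_closure[OF M IE AI])
  then have "closure_in M I = ground M" using span closure_in_subset[OF M IE] by blast
  then show "\<exists>B\<in>matroid_bases M. B \<subseteq> A" using base_iff[OF M] I(1) by blast
next
  assume "\<exists>B\<in>matroid_bases M. B \<subseteq> A"
  then obtain B where "B \<subseteq> A" "closure_in M B = ground M" using base_iff[OF M] by blast
  then show "closure_in M A = ground M"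
    using closure_in_mono[of B A M] closure_in_subset[OF M A] by blast
qed

lemma codependent_iff:
  assumes M: "oriented_matroid M"
  shows "codependent M D \<longleftrightarrow> D \<subseteq> ground M \<and> closure_in M (ground M - D) \<noteq> ground M"
proof -
  have "B \<subseteq> ground M" if "B \<in> matroid_bases M" for B
    using that by (auto simp: matroid_bases_def independent_def)
  then show ?thesis
    unfolding codependent_def spanning_iff_base[OF M Diff_subset] by blast
qed

text \<open>The complement is a hyperplane: minimality of \<open>D\<close> makes it a maximal
  nonspanning set, hence closed.\<close>

lemma matroid_cocircuit_complement:
  assumes M: "oriented_matroid M" and D: "D \<in> matroid_cocircuits M"
  shows "D \<subseteq> ground M" "D \<noteq> {}"
    and "closure_in M (ground M - D) = ground M - D"
    and "\<And>x. x \<in> D \<Longrightarrow> closure_in M (insert x (ground M - D)) = ground M"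
proof -
  let ?H = "ground M - D"
  have cod: "D \<subseteq> ground M" "closure_in M ?H \<noteq> ground M"
    and min: "\<And>D'. codependent M D' \<Longrightarrow> \<not> D' \<subset> D"
    using D unfolding matroid_cocircuits_def codependent_iff[OF M] by blast+
  show "D \<subseteq> ground M" by fact
  show "D \<noteq> {}" using cod closure_in_superset[of "ground M" M] closure_in_subset[OF M, of "ground M"]
    by auto
  have span: "closure_in M A = ground M" if A: "?H \<subset> A" "A \<subseteq> ground M" for A
  proof (rule ccontr)
    assume "closure_in M A \<noteq> ground M"
    moreover have "ground M - (ground M - A) = A" using A by blast
    ultimately have "codependent M (ground M - A)" unfolding codependent_iff[OF M] by auto
    moreover have "ground M - A \<subset> D" using A by blast
    ultimately show False using min by blast
  qed
  show "closure_in M ?H = ?H"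
  proof (rule ccontr)
    assume "closure_in M ?H \<noteq> ?H"
    then have "?H \<subset> closure_in M ?H" using closure_in_superset[of ?H M] by blast
    moreover have sub: "closure_in M ?H \<subseteq> ground M" by (rule closure_in_subset[OF M Diff_subset])
    ultimately have "closure_in M (closure_in M ?H) = ground M" by (rule span)
    then have "ground M \<subseteq> closure_in M ?H"
      using closure_in_closure[OF M Diff_subset order_refl, of D] by simp
    then show False using cod(2) sub by blast
  qed
  show "closure_in M (insert x ?H) = ground M" if "x \<in> D" for x
    using span[of "insert x ?H"] that cod(1) by blast
qed

text \<open>Such a circuit would put \<open>x\<close> into the closure of the complement of
  \<open>D\<close>, which is closed.\<close>

lemma circuit_cocircuit_not_single:
  assumes M: "oriented_matroid M" and "D \<in> matroid_cocircuits M" "C \<in> matroid_circuits M"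
  shows "C \<inter> D \<noteq> {x}"
proof
  assume x: "C \<inter> D = {x}"
  then have "C \<subseteq> insert x (ground M - D)" using matroid_circuit_subset[OF M assms(3)] by blast
  then have "x \<in> closure_in M (ground M - D)" using x assms(3) unfolding closure_in_def by blast
  then show False using matroid_cocircuit_complement(3)[OF M assms(2)] x by blast
qed

text \<open>Adding \<open>e\<close> to the hyperplane spans \<open>f\<close>. The circuit that shows
  this must use \<open>e\<close>, as it cannot meet \<open>D\<close> in \<open>f\<close>
  alone.\<close>

lemma cocircuit_pair:
  assumes M: "oriented_matroid M" and D: "D \<in> matroid_cocircuits M" and ef: "e \<in> D" "f \<in> D" "e \<noteq> f"
  obtains C where "C \<in> matroid_circuits M" "C \<inter> D = {e, f}"
proof -
  have "f \<in> closure_in M (insert e (ground M - D))"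
    using matroid_cocircuit_complement(1,4)[OF M D] ef by blast
  then obtain C where C: "C \<in> matroid_circuits M" "f \<in> C" "C \<subseteq> insert f (insert e (ground M - D))"
    using ef unfolding closure_in_def by blast
  then have "C \<inter> D = {e, f}" using circuit_cocircuit_not_single[OF M D C(1), of f] ef by blast
  then show ?thesis using that C(1) by blast
qed

text \<open>If \<open>e\<close> is not in the closure of \<open>G\<close>, enlarge \<open>G\<close>
  to a set \<open>H\<close> maximal with this property. By exchange \<open>H\<close> together with
  \<open>e\<close> spans, so \<open>H\<close> is a hyperplane, and its complement is the
  cocircuit.\<close>

lemma matroid_painting:
  assumes M: "oriented_matroid M" and e: "e \<in> ground M" "e \<notin> G" and G: "G \<subseteq> ground M"
  shows "(\<exists>C\<in>matroid_circuits M. e \<in> C \<and> C \<subseteq> insert e G) \<or>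
    (\<exists>D\<in>matroid_cocircuits M. e \<in> D \<and> D \<inter> G = {})"
proof (cases "e \<in> closure_in M G")
  case True
  then show ?thesis using e unfolding closure_in_def by blast
next
  case False
  let ?S = "{H. G \<subseteq> H \<and> H \<subseteq> ground M \<and> e \<notin> closure_in M H}"
  have "finite ?S"
    using om_finite[OF M] by (auto intro: finite_subset[of _ "Pow (ground M)"])
  moreover have "G \<in> ?S" using False G by blast
  ultimately obtain H where H: "H \<in> ?S" "\<forall>J\<in>?S. H \<subseteq> J \<longrightarrow> H = J"
    using finite_has_maximal[of ?S] by blast
  have eH: "e \<notin> H" using H(1) closure_in_superset[of H M] by blast
  have ecl: "e \<in> closure_in M (insert y H)" if y: "y \<in> ground M" "y \<notin> H" for y
    using H y by blast
  have "y \<in> closure_in M (insert e H)" if y: "y \<in> ground M" for y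
  proof (cases "y \<in> insert e H")
    case True
    then show ?thesis using closure_in_superset[of "insert e H" M] by blast
  next
    case False
    then obtain C where C: "C \<in> matroid_circuits M" "e \<in> C" "C \<subseteq> insert e (insert y H)"
      using ecl[of y] y eH unfolding closure_in_def by blast
    have "y \<in> C" using C H(1) unfolding closure_in_def by blast
    then show ?thesis using C unfolding closure_in_def by blast
  qed
  then have span: "ground M \<subseteq> closure_in M (insert e H)" by blast
  have "closure_in M J = ground M" if J: "H \<subset> J" "J \<subseteq> ground M" for J
  proof -
    have "e \<in> closure_in M J" using H J by blast
    then have "insert e H \<subseteq> closure_in M J" using closure_in_superset[of J M] J(1) by blast
    then have "closure_in M (insert e H) \<subseteq> closure_in M J" by (rule closure_in_closure[OF M J(2)])
    then show ?thesis using span closure_in_subset[OF M J(2)] by blast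
  qed
  then have min: "\<not> D' \<subset> ground M - H" if "codependent M D'" for D'
  proof -
    have "D' \<subseteq> ground M" "closure_in M (ground M - D') \<noteq> ground M"
      using that codependent_iff[OF M] by blast+
    then have "\<not> H \<subset> ground M - D'"
      using \<open>\<And>J. H \<subset> J \<Longrightarrow> J \<subseteq> ground M \<Longrightarrow> closure_in M J = ground M\<close> by blast
    then show ?thesis using H(1) \<open>D' \<subseteq> ground M\<close> by blast
  qed
  have "ground M - (ground M - H) = H" using H(1) by blast
  then have "codependent M (ground M - H)"
    using H(1) e(1) unfolding codependent_iff[OF M] by auto
  then have "ground M - H \<in> matroid_cocircuits M" using min unfolding matroid_cocircuits_def by blast
  moreover have "e \<in> ground M - H" "(ground M - H) \<inter> G = {}" using H(1) e(1) eH by blast+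
  ultimately show ?thesis by (intro disjI2 bexI[of _ "ground M - H"] conjI)
qed

subsection \<open>Signatures of cocircuits and the painting lemma\<close>

text \<open>With \<open>H\<close> the complement of \<open>D\<close>, the contraction of \<open>H\<close> has rank one: its circuits are pairs,
  and incomparability makes the sign relation between two elements of \<open>D\<close> well defined. The signs
  are chosen opposite to those of the circuits \<open>B f\<close> through a fixed \<open>c\<close>, and it suffices that no
  circuit of the contraction conforms to the opposite signature.\<close>

lemma cocircuit_signature:
  assumes M: "oriented_matroid M" and D: "D \<in> matroid_cocircuits M"
  obtains Y where "Y \<in> cocircuits M" "supp Y = D"
proof -
  let ?H = "ground M - D" let ?P = "om_contract M ?H"
  have finH: "finite ?H" using om_finite[OF M] by simp
  have P: "oriented_matroid ?P" by (rule om_contract[OF M finH])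
  note DE = matroid_cocircuit_complement(1)[OF M D]
  obtain c where c: "c \<in> D" using matroid_cocircuit_complement(2)[OF M D] by blast
  have trace: "supp Z - ?H = supp Z \<inter> D" if "Z \<in> circuits M" for Z
    using om_circuit(2)[OF M that] by blast
  have not_single: "supp Z \<inter> D \<noteq> {x}" if "Z \<in> circuits M" for Z x
  proof -
    have "supp Z \<in> matroid_circuits M" using that matroid_circuits_iff by metis
    then show ?thesis by (rule circuit_cocircuit_not_single[OF M D])
  qed
  have pair: "\<exists>X\<in>circuits ?P. supp X = {e, f} \<and> e \<in> fst X" if ef: "e \<in> D" "f \<in> D" "e \<noteq> f" for e f
  proof -
    obtain C where C: "C \<in> matroid_circuits M" "C \<inter> D = {e, f}"
      using cocircuit_pair[OF M D ef] .
    then obtain Z where Z: "Z \<in> circuits M" "supp Z = C" unfolding matroid_circuits_iff by metis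
    have "(fst Z - ?H, snd Z - ?H) \<in> circuits ?P"
    proof (rule contract_circuitI[OF Z(1)])
      show "supp Z - ?H \<noteq> {}" using trace[OF Z(1)] Z(2) C(2) by simp
      fix W assume W: "W \<in> circuits M" "supp W - ?H \<noteq> {}"
      have "supp W \<inter> D \<noteq> {e}" "supp W \<inter> D \<noteq> {f}" using not_single[OF W(1)] by simp_all
      moreover have "supp W \<inter> D \<noteq> {}" using W(2) trace[OF W(1)] by simp
      moreover have "A = {} \<or> A = {e} \<or> A = {f}" if "A \<subset> {e, f}" for A
        using that by blast
      ultimately show "\<not> supp W - ?H \<subset> supp Z - ?H"
        using C(2) Z(2) trace[OF Z(1)] trace[OF W(1)] by metis
    qed
    moreover have "supp (fst Z - ?H, snd Z - ?H) = {e, f}"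
      using trace[OF Z(1)] Z(2) C(2) by (simp only: supp_trace)
    ultimately obtain X where "X \<in> circuits ?P" "supp X = {e, f}" "e \<in> fst X"
      using om_orient_at[OF P, of "(fst Z - ?H, snd Z - ?H)" e] by auto
    then show ?thesis by blast
  qed
  \<comment> \<open>A trace on \<open>D\<close> is never a single element, and any two of its
    elements already support a circuit, so by incomparability there are no others.\<close>
  have P_pair: "e \<in> D \<and> (\<exists>f\<in>D - {e}. supp X = {e, f})" if X: "X \<in> circuits ?P" "e \<in> supp X" for X e
  proof -
    obtain Z where Z: "Z \<in> circuits M" "supp X = supp Z - ?H" "supp X \<noteq> {}"
      using contract_circuitE[OF X(1)] by metis
    then have XD: "supp X = supp Z \<inter> D" using trace by simp
    have "supp X \<noteq> {e}" using not_single[OF Z(1)] XD by simp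
    then obtain f where f: "f \<in> supp X" "e \<noteq> f" using X(2) by blast
    have "e \<in> D" "f \<in> D" using X(2) f XD by simp_all
    then obtain X' where X': "X' \<in> circuits ?P" "supp X' = {e, f}" using pair[OF _ _ f(2)] by metis
    then have "supp X = {e, f}" using om_antichain[OF P X'(1) X(1)] X(2) f by auto
    then show ?thesis using f(2) \<open>e \<in> D\<close> \<open>f \<in> D\<close> by blast
  qed
  have "\<forall>f\<in>D - {c}. \<exists>X. X \<in> circuits ?P \<and> supp X = {c, f} \<and> c \<in> fst X"
    using pair[OF c] by blast
  then obtain B where B: "\<And>f. f \<in> D - {c} \<Longrightarrow> B f \<in> circuits ?P \<and> supp (B f) = {c, f} \<and> c \<in> fst (B f)"
    by metis
  have B_disj: "fst (B f) \<inter> snd (B f) = {}" if "f \<in> D - {c}" for f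
    using om_circuit(1)[OF P] B[OF that] by blast
  have B_unique: "X = B f" if X: "X \<in> circuits ?P" "supp X = {c, f}" "c \<in> fst X" "f \<in> D - {c}" for X f
  proof -
    have "X = B f \<or> X = opposite (B f)"
      using om_incomparable[OF P X(1), of "B f"] B[OF X(4)] X(2) by simp
    then show ?thesis using X(3) B[OF X(4)] B_disj[OF X(4)] by (auto simp: opposite_def)
  qed
  define pos where "pos = insert c {f \<in> D - {c}. f \<in> snd (B f)}"
  define neg where "neg = {f \<in> D - {c}. f \<in> fst (B f)}"
  have "f \<in> fst (B f) \<or> f \<in> snd (B f)" if "f \<in> D - {c}" for f
    using B[OF that] unfolding supp_def by blast
  then have pos_neg: "pos \<union> neg = D" using c unfolding pos_def neg_def by blast
  have pos_neg_disj: "pos \<inter> neg = {}" using B_disj unfolding pos_def neg_def by blast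
  have no: False if X: "X \<in> circuits ?P" "fst X \<subseteq> neg" "snd X \<subseteq> pos" for X
  proof -
    have disj: "fst X \<inter> snd X = {}" using om_circuit(1)[OF P X(1)] .
    obtain e where eX: "e \<in> supp X" using om_circuit(3)[OF P X(1)] by blast
    obtain f where ef: "e \<in> D" "f \<in> D" "e \<noteq> f" "supp X = {e, f}"
      using P_pair[OF X(1) eX] by blast
    show False
    proof (cases "c \<in> supp X")
      case True
      then obtain h where h: "h \<in> D - {c}" "supp X = {c, h}" using P_pair[OF X(1)] by blast
      have "c \<in> snd X" using True X(2) unfolding neg_def supp_def by blast
      then have "c \<in> fst (opposite X)" by (simp add: opposite_def)
      then have "opposite X = B h"
        using B_unique[OF om_opposite[OF P X(1)] _ _ h(1)] h(2) by simp
      then have "fst (B h) = snd X" "snd (B h) = fst X" by (simp_all add: opposite_def prod_eq_iff)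
      then have "h \<in> fst X \<Longrightarrow> h \<notin> neg" "h \<in> snd X \<Longrightarrow> h \<notin> pos"
        using disj h(1) unfolding pos_def neg_def by blast+
      moreover have "h \<in> fst X \<or> h \<in> snd X" using h(2) unfolding supp_def by blast
      ultimately show False using X(2,3) by blast
    next
      \<comment> \<open>Eliminating \<open>e\<close> between \<open>B e\<close> and the opposite of
        \<open>X\<close> leaves a circuit on \<open>{c, f}\<close> that is positive at
        \<open>c\<close>, hence \<open>B f\<close>. Its sign at \<open>f\<close> is opposite to that
        of \<open>X\<close>, which places \<open>f\<close> in both \<open>pos\<close> and
        \<open>neg\<close>.\<close>
      case cX: False
      then have e: "e \<in> D - {c}" and f: "f \<in> D - {c}" using ef by auto
      have snd_B: "snd (B e) \<subseteq> {e}" "fst (B e) \<subseteq> {c, e}"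
        using B[OF e] B_disj[OF e] unfolding supp_def by blast+
      have neq: "B e \<noteq> X" using B[OF e] cX by (metis insertI1)
      have "\<exists>Z\<in>circuits ?P. fst Z \<subseteq> fst (B e) \<union> snd X - {e} \<and> snd Z \<subseteq> snd (B e) \<union> fst X - {e}"
      proof (cases "e \<in> fst X")
        case True
        then have "e \<in> fst (B e)" "e \<in> snd (opposite X)"
          using X(2) unfolding neg_def opposite_def by auto
        moreover have "B e \<in> circuits ?P" "B e \<noteq> opposite (opposite X)"
          using B[OF e] neq by simp_all
        ultimately obtain Z where "Z \<in> circuits ?P" "fst Z \<subseteq> fst (B e) \<union> fst (opposite X) - {e}"
            "snd Z \<subseteq> snd (B e) \<union> snd (opposite X) - {e}"
          using om_elim[OF P _ om_opposite[OF P X(1)], of "B e" e] by metis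
        then show ?thesis unfolding opposite_def by auto
      next
        case False
        then have "e \<in> snd X" using ef(4) unfolding supp_def by blast
        then have "e \<in> snd (B e)" "e \<in> fst (opposite X)"
          using X(3) e unfolding pos_def opposite_def by auto
        moreover have "opposite X \<noteq> opposite (B e)" using neq by (metis opposite_opposite)
        moreover have "B e \<in> circuits ?P" using B[OF e] by blast
        ultimately obtain Z where "Z \<in> circuits ?P" "fst Z \<subseteq> fst (opposite X) \<union> fst (B e) - {e}"
            "snd Z \<subseteq> snd (opposite X) \<union> snd (B e) - {e}"
          using om_elim[OF P om_opposite[OF P X(1)], of "B e" e] by metis
        then show ?thesis unfolding opposite_def by auto
      qed
      then obtain Z where Z: "Z \<in> circuits ?P" "fst Z \<subseteq> fst (B e) \<union> snd X - {e}"
          "snd Z \<subseteq> snd (B e) \<union> fst X - {e}" by blast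
      have Zb: "fst Z \<subseteq> insert c (snd X)" "snd Z \<subseteq> fst X" using Z(2,3) snd_B by blast+
      have "supp Z \<subseteq> {c, f}" using Z(2,3) snd_B ef(4) unfolding supp_def by blast
      moreover obtain a where "a \<in> supp Z" using om_circuit(3)[OF P Z(1)] by blast
      ultimately have sZ: "supp Z = {c, f}" using P_pair[OF Z(1), of a] by auto
      moreover have "c \<in> fst Z" using sZ Zb(2) cX unfolding supp_def by blast
      ultimately have "Z = B f" using B_unique[OF Z(1) _ _ f] by simp
      then have "f \<in> fst Z \<Longrightarrow> f \<in> neg" "f \<in> snd Z \<Longrightarrow> f \<in> pos" using f unfolding pos_def neg_def by auto
      moreover have "f \<in> fst Z \<or> f \<in> snd Z" using sZ unfolding supp_def by blast
      moreover have "f \<noteq> c" using f by simp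
      ultimately show False using Zb X(2,3) pos_neg_disj by blast
    qed
  qed
  have orth: "orthogonal Z (pos, neg)" if Z: "Z \<in> circuits M" for Z
  proof (cases "supp Z \<inter> D = {}")
    case True
    then show ?thesis using pos_neg by (simp add: orthogonal_def supp_def)
  next
    case False
    then obtain x where "x \<in> supp Z - ?H" by blast
    then obtain X where X: "X \<in> circuits ?P" "fst X \<subseteq> fst Z" "snd X \<subseteq> snd Z"
      using trace_conformal[OF M finH Z] by blast
    have "supp X \<subseteq> D" using P_pair[OF X(1)] by blast
    then have sub: "fst X \<subseteq> pos \<union> neg" "snd X \<subseteq> pos \<union> neg" using pos_neg unfolding supp_def by auto
    \<comment> \<open>Excluding \<open>X\<close> yields an agreement with \<open>(pos, neg)\<close>,
      excluding its opposite a disagreement; both persist in \<open>Z\<close> because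
      \<open>X\<close> conforms to \<open>Z\<close>.\<close>
    have "fst X \<inter> pos \<noteq> {} \<or> snd X \<inter> neg \<noteq> {}" using no[OF X(1)] sub by blast
    moreover have "snd X \<inter> pos \<noteq> {} \<or> fst X \<inter> neg \<noteq> {}"
      using no[OF om_opposite[OF P X(1)]] sub unfolding opposite_def by auto
    ultimately show ?thesis using X(2,3) unfolding orthogonal_def by auto
  qed
  show ?thesis
  proof (rule that)
    show supp: "supp (pos, neg) = D" using pos_neg by (simp add: supp_def)
    then show "(pos, neg) \<in> cocircuits M"
      using DE D orth pos_neg_disj by (simp add: cocircuits_def signed_subset_def)
  qed
qed

lemma opposite_cocircuit: "Y \<in> cocircuits M \<Longrightarrow> opposite Y \<in> cocircuits M"
  unfolding cocircuits_def signed_subset_def orthogonal_def supp_def opposite_def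
  by (auto simp: Un_commute)

lemma cocircuit_signature_at:
  assumes M: "oriented_matroid M" and D: "D \<in> matroid_cocircuits M" "e \<in> D"
  obtains Y where "Y \<in> cocircuits M" "supp Y = D" "e \<in> fst Y"
proof -
  obtain Y where Y: "Y \<in> cocircuits M" "supp Y = D" using cocircuit_signature[OF M D(1)] .
  show ?thesis
  proof (cases "e \<in> fst Y")
    case False
    then have "e \<in> fst (opposite Y)" using D(2) Y(2) by (auto simp: supp_def opposite_def)
    then show ?thesis using that[OF opposite_cocircuit[OF Y(1)]] Y(2) by simp
  qed (use that Y in blast)
qed

text \<open>Minty's painting lemma: \<open>R\<close> is to be avoided by the circuit, \<open>G\<close> by the cocircuit, and the
  elements outside \<open>R \<union> G\<close> must be positive. An element \<open>f\<close> outside is moved once to \<open>R\<close> and once to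
  \<open>G\<close>; if neither case helps directly, orthogonality forces the circuit and the cocircuit found to
  have opposite signs at \<open>f\<close>, so that one of them is positive there.\<close>

lemma painting:
  assumes M: "oriented_matroid M"
    and "R \<subseteq> ground M" "G \<subseteq> ground M" "R \<inter> G = {}" "e \<in> ground M" "e \<notin> R" "e \<notin> G"
  shows "(\<exists>Z\<in>circuits M. e \<in> fst Z \<and> snd Z \<subseteq> G \<and> supp Z \<inter> R = {}) \<or>
    (\<exists>Y\<in>cocircuits M. e \<in> fst Y \<and> snd Y \<subseteq> R \<and> supp Y \<inter> G = {})"
  using assms(2-)
proof (induction "card (ground M - R - G)" arbitrary: R G rule: less_induct)
  case less
  show ?case
  proof (cases "ground M - R - G \<subseteq> {e}")
    \<comment> \<open>No element besides \<open>e\<close> has a prescribed sign, so it is enough to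
      orient the unsigned circuit or cocircuit at \<open>e\<close>.\<close>
    case True
    from matroid_painting[OF M less.prems(4,6,2)] show ?thesis
    proof (elim disjE bexE conjE)
      fix C assume C: "C \<in> matroid_circuits M" "e \<in> C" "C \<subseteq> insert e G"
      then obtain Z where Z: "Z \<in> circuits M" "supp Z = C" "e \<in> fst Z"
        using om_orient_at[OF M] matroid_circuits_iff by metis
      have "fst Z \<inter> snd Z = {}" using om_circuit(1)[OF M Z(1)] .
      then have "snd Z \<subseteq> G" "supp Z \<inter> R = {}"
        using Z(2,3) C(3) less.prems(3,5) unfolding supp_def by blast+
      then show ?thesis using Z by blast
    next
      fix D assume D: "D \<in> matroid_cocircuits M" "e \<in> D" "D \<inter> G = {}"
      obtain Y where Y: "Y \<in> cocircuits M" "supp Y = D" "e \<in> fst Y"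
        using cocircuit_signature_at[OF M D(1,2)] .
      have "fst Y \<inter> snd Y = {}" "supp Y \<subseteq> ground M"
        using Y(1) by (auto simp: cocircuits_def signed_subset_def)
      then have "snd Y \<subseteq> R" "supp Y \<inter> G = {}"
        using Y(2,3) D(3) True unfolding supp_def by blast+
      then show ?thesis using Y by blast
    qed
  next
    case False
    then obtain f where f: "f \<in> ground M" "f \<notin> R" "f \<notin> G" "f \<noteq> e" by blast
    have fin: "finite (ground M - R - G)" using om_finite[OF M] by simp
    have "card (ground M - insert f R - G) < card (ground M - R - G)"
      by (rule psubset_card_mono[OF fin]) (use f in blast)
    from less.hyps[OF this] less.prems f
    consider Z where "Z \<in> circuits M" "e \<in> fst Z" "snd Z \<subseteq> G" "supp Z \<inter> insert f R = {}"
      | Y where "Y \<in> cocircuits M" "e \<in> fst Y" "snd Y \<subseteq> insert f R" "supp Y \<inter> G = {}"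
      by auto
    then show ?thesis
    proof cases
      case 1
      then show ?thesis by blast
    next
      case (2 Y)
      have "card (ground M - R - insert f G) < card (ground M - R - G)"
        by (rule psubset_card_mono[OF fin]) (use f in blast)
      from less.hyps[OF this] less.prems f
      consider Z where "Z \<in> circuits M" "e \<in> fst Z" "snd Z \<subseteq> insert f G" "supp Z \<inter> R = {}"
        | Y where "Y \<in> cocircuits M" "e \<in> fst Y" "snd Y \<subseteq> R" "supp Y \<inter> insert f G = {}"
        by auto
      then show ?thesis
      proof cases
        case (1 Z)
        have "orthogonal Z Y" using 1(1) 2(1) by (simp add: cocircuits_def)
        then have "fst Z \<inter> snd Y \<union> snd Z \<inter> fst Y \<noteq> {}"
          using 1(2) 2(2) unfolding orthogonal_def supp_def by blast
        then have "f \<in> fst Z \<or> f \<in> fst Y"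
          using 1(3,4) 2(3,4) unfolding supp_def by blast
        moreover have "fst Z \<inter> snd Z = {}" using om_circuit(1)[OF M 1(1)] .
        moreover have "fst Y \<inter> snd Y = {}" using 2(1) by (simp add: cocircuits_def signed_subset_def)
        ultimately have "snd Z \<subseteq> G \<or> snd Y \<subseteq> R" using 1(3) 2(3) by blast
        then show ?thesis using 1 2 by blast
      next
        case 2
        then show ?thesis by blast
      qed
    qed
  qed
qed

subsection \<open>Positive circuits and positive cocircuits\<close>

lemma positive_circuits_iff: "C \<in> positive_circuits M \<longleftrightarrow> (C, {}) \<in> circuits M"
  unfolding positive_circuits_def positive_def supp_def by force

lemma positive_cocircuits_iff: "D \<in> positive_cocircuits M \<longleftrightarrow> (D, {}) \<in> cocircuits M"
  unfolding positive_cocircuits_def positive_def supp_def by force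

lemma positive_circuit:
  assumes "oriented_matroid M" "C \<in> positive_circuits M"
  shows "C \<subseteq> ground M" "C \<noteq> {}" "finite C"
  using om_circuit[OF assms(1), of "(C, {})"] assms(2) om_finite[OF assms(1)]
  by (auto simp: positive_circuits_iff supp_def intro: finite_subset)

lemma positive_cocircuit:
  assumes "oriented_matroid M" "D \<in> positive_cocircuits M"
  shows "D \<subseteq> ground M" "D \<noteq> {}" "finite D"
proof -
  have "D \<in> matroid_cocircuits M"
    using assms(2) by (simp add: positive_cocircuits_iff cocircuits_def supp_def)
  then show "D \<subseteq> ground M" "D \<noteq> {}" using matroid_cocircuit_complement[OF assms(1)] by blast+
  then show "finite D" using om_finite[OF assms(1)] by (meson finite_subset)
qed

lemma positive_cocircuit_orth:
  assumes "D \<in> positive_cocircuits M" "Z \<in> circuits M" "snd Z \<inter> D = {}"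
  shows "supp Z \<inter> D = {}"
proof -
  have "orthogonal Z (D, {})" using assms by (simp add: positive_cocircuits_iff cocircuits_def)
  then show ?thesis using assms(3) by (auto simp: orthogonal_def supp_def)
qed

lemma positive_circuit_orth:
  assumes "C \<in> positive_circuits M" "Y \<in> cocircuits M" "snd Y \<inter> C = {}"
  shows "supp Y \<inter> C = {}"
proof -
  have "orthogonal (C, {}) Y" using assms by (auto simp: positive_circuits_iff cocircuits_def)
  then show ?thesis using assms(3) by (auto simp: orthogonal_def supp_def)
qed

text \<open>Painting with nothing forbidden to the circuit, so that the cocircuit has no negative
  element. The first alternative describes the circuits that become positive once \<open>L\<close>
  is contracted.\<close>

lemma farkas_contract:
  assumes M: "oriented_matroid M" and L: "L \<subseteq> ground M" and x: "x \<in> ground M" "x \<notin> L"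
  shows "(\<exists>Z\<in>circuits M. x \<in> fst Z \<and> snd Z \<subseteq> L) \<or>
    (\<exists>D\<in>positive_cocircuits M. x \<in> D \<and> D \<inter> L = {})"
  using painting[OF M empty_subsetI L _ x(1) _ x(2)]
  by (auto simp: positive_cocircuits_iff supp_def)

text \<open>Painting with the complement of \<open>B\<close> forbidden to the circuit and no element
  allowed to be negative on it. The second alternative describes the cocircuits that are nonnegative
  on \<open>B\<close>.\<close>

lemma farkas_restrict:
  assumes M: "oriented_matroid M" and B: "B \<subseteq> ground M" and x: "x \<in> B"
  shows "(\<exists>C\<in>positive_circuits M. x \<in> C \<and> C \<subseteq> B) \<or>
    (\<exists>Y\<in>cocircuits M. x \<in> fst Y \<and> snd Y \<inter> B = {})"
proof -
  have "x \<in> ground M" using B x by blast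
  then consider Z where "Z \<in> circuits M" "x \<in> fst Z" "snd Z \<subseteq> {}" "supp Z \<inter> (ground M - B) = {}"
    | Y where "Y \<in> cocircuits M" "x \<in> fst Y" "snd Y \<subseteq> ground M - B"
    using painting[OF M Diff_subset[of "ground M" B] empty_subsetI] x by blast
  then show ?thesis
  proof cases
    case 1
    have "(fst Z, {}) = Z" using 1(3) by (simp add: prod_eq_iff)
    moreover have "fst Z \<subseteq> B" using 1(4) om_circuit(2)[OF M 1(1)] unfolding supp_def by blast
    ultimately have "fst Z \<in> positive_circuits M" "fst Z \<subseteq> B"
      using 1(1) by (simp_all add: positive_circuits_iff)
    then show ?thesis using 1(2) by blast
  next
    case 2
    then show ?thesis by blast
  qed
qed

subsection \<open>Minors\<close>

abbreviation minor :: "'a omatroid \<Rightarrow> 'a set \<Rightarrow> 'a set \<Rightarrow> 'a omatroid" where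
  "minor M F G \<equiv> om_contract (om_restrict M F) G"

lemma om_restrict:
  assumes "oriented_matroid M"
  shows "oriented_matroid (om_restrict M F)"
  unfolding oriented_matroid_def
proof (intro conjI ballI allI impI)
  let ?R = "om_restrict M F"
  show "finite (ground ?R)" using om_finite[OF assms] by (simp add: om_restrict_def)
  fix X assume "X \<in> circuits ?R"
  then have X: "X \<in> circuits M" "supp X \<subseteq> F" by (auto simp: om_restrict_def)
  show "supp X \<noteq> {}" using om_circuit[OF assms X(1)] by blast
  show "signed_subset X (ground ?R)"
    using om_circuit[OF assms X(1)] X(2) by (auto simp: om_restrict_def signed_subset_def)
  show "opposite X \<in> circuits ?R" using om_opposite[OF assms X(1)] X(2) by (simp add: om_restrict_def)
  fix Y assume "Y \<in> circuits ?R"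
  then have Y: "Y \<in> circuits M" "supp Y \<subseteq> F" by (auto simp: om_restrict_def)
  show "X = Y \<or> X = opposite Y" if "supp X \<subseteq> supp Y" using om_incomparable[OF assms X(1) Y(1) that] .
  fix e assume "X \<noteq> opposite Y \<and> e \<in> fst X \<inter> snd Y"
  then obtain Z where Z: "Z \<in> circuits M" "fst Z \<subseteq> fst X \<union> fst Y - {e}" "snd Z \<subseteq> snd X \<union> snd Y - {e}"
    using om_elim[OF assms X(1) Y(1)] by blast
  then have "supp Z \<subseteq> F" using X(2) Y(2) unfolding supp_def by blast
  then show "\<exists>Z\<in>circuits ?R. fst Z \<subseteq> fst X \<union> fst Y - {e} \<and> snd Z \<subseteq> snd X \<union> snd Y - {e}"
    using Z by (intro bexI[of _ Z]) (simp_all add: om_restrict_def)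
qed

lemma om_minor: "oriented_matroid M \<Longrightarrow> finite G \<Longrightarrow> oriented_matroid (minor M F G)"
  by (simp add: om_contract om_restrict)

lemma ground_minor [simp]: "ground (minor M F G) = ground M \<inter> F - G"
  by (simp add: om_contract_def om_restrict_def)

lemma minor_circuitE:
  assumes "X \<in> circuits (minor M F G)"
  obtains Z where "Z \<in> circuits M" "supp Z \<subseteq> F" "fst X = fst Z - G" "snd X = snd Z - G"
    "supp X = supp Z - G"
proof -
  obtain Z where Z: "Z \<in> circuits (om_restrict M F)" "X = (fst Z - G, snd Z - G)"
      "supp X = supp Z - G"
    using contract_circuitE[OF assms] .
  then show ?thesis using that[of Z] by (simp add: om_restrict_def)
qed

lemma minor_positive_circuitE:
  assumes "oriented_matroid M" "finite G" "C \<in> positive_circuits (minor M F G)"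
  obtains Z where "Z \<in> circuits M" "supp Z \<subseteq> F" "snd Z \<subseteq> G" "C = fst Z - G" "C \<noteq> {}"
proof -
  have C: "(C, {}) \<in> circuits (minor M F G)" using assms(3) by (simp add: positive_circuits_iff)
  obtain Z where "Z \<in> circuits M" "supp Z \<subseteq> F" "C = fst Z - G" "{} = snd Z - G"
    using minor_circuitE[OF C] unfolding fst_conv snd_conv by metis
  moreover have "C \<noteq> {}" using positive_circuit(2)[OF om_minor[OF assms(1,2)] assms(3)] .
  ultimately show ?thesis using that by blast
qed

lemma minor_conformal:
  assumes "oriented_matroid M" "finite G" "Z \<in> circuits M" "supp Z \<subseteq> F" "x \<in> supp Z - G"
  shows "\<exists>X\<in>circuits (minor M F G). x \<in> supp X \<and> fst X \<subseteq> fst Z \<and> snd X \<subseteq> snd Z"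
  by (rule trace_conformal[OF om_restrict[OF assms(1)] assms(2) _ assms(5)])
    (use assms(3,4) in \<open>simp add: om_restrict_def\<close>)

lemma minor_positive_trace:
  assumes "oriented_matroid M" "finite G" "Z \<in> circuits M" "supp Z \<subseteq> F" "snd Z \<subseteq> G" "x \<in> supp Z - G"
  obtains C where "C \<in> positive_circuits (minor M F G)" "x \<in> C" "C \<subseteq> supp Z"
proof -
  obtain X where X: "X \<in> circuits (minor M F G)" "x \<in> supp X" "fst X \<subseteq> fst Z" "snd X \<subseteq> snd Z"
    using minor_conformal[OF assms(1-4,6)] by blast
  have "supp X \<inter> G = {}" by (rule contract_circuit_disjoint[OF X(1)])
  then have "X = (fst X, {})" "x \<in> fst X"
    using X(2,4) assms(5) unfolding supp_def prod_eq_iff by auto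
  then have "fst X \<in> positive_circuits (minor M F G)" using X(1) by (simp add: positive_circuits_iff)
  then show ?thesis using that \<open>x \<in> fst X\<close> X(3) unfolding supp_def by blast
qed

text \<open>Replaces the lifting of \<open>D\<close> to the whole matroid: a circuit of
  \<open>M\<close> inside \<open>F\<close> that meets \<open>D\<close> has a conformal trace in the
  minor through the same point, and there orthogonality applies.\<close>

lemma minor_positive_cocircuit_orth:
  assumes M: "oriented_matroid M" and G: "finite G" and D: "D \<in> positive_cocircuits (minor M F G)"
    and Z: "Z \<in> circuits M" "supp Z \<subseteq> F" "snd Z \<inter> D = {}"
  shows "supp Z \<inter> D = {}"
proof (rule ccontr)
  assume "supp Z \<inter> D \<noteq> {}"
  then obtain x where x: "x \<in> supp Z" "x \<in> D" by blast
  moreover have "D \<inter> G = {}" using positive_cocircuit(1)[OF om_minor[OF M G] D] by auto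
  ultimately obtain X where X: "X \<in> circuits (minor M F G)" "x \<in> supp X" "snd X \<subseteq> snd Z"
    using minor_conformal[OF M G Z(1,2)] by blast
  then have "supp X \<inter> D = {}" using positive_cocircuit_orth[OF D X(1)] Z(3) by blast
  then show False using X(2) x(2) by blast
qed

subsection \<open>Bounded matroids are connected\<close>

lemma matroid_connected_via:
  assumes P: "oriented_matroid P" and p: "p \<in> ground P"
    and x: "\<And>x. x \<in> ground P \<Longrightarrow> x \<noteq> p \<Longrightarrow> \<exists>C\<in>matroid_circuits P. p \<in> C \<and> x \<in> C"
  shows "matroid_connected P"
  unfolding matroid_connected_def
proof (intro ballI impI)
  fix e f assume ef: "e \<in> ground P" "f \<in> ground P" "e \<noteq> f"
  show "\<exists>C\<in>matroid_circuits P. e \<in> C \<and> f \<in> C"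
  proof (cases "e = p \<or> f = p")
    case True
    then show ?thesis using x ef by metis
  next
    case False
    then obtain C C' where C: "C \<in> matroid_circuits P" "p \<in> C" "e \<in> C"
        "C' \<in> matroid_circuits P" "p \<in> C'" "f \<in> C'"
      using x ef by metis
    then show ?thesis using matroid_common_circuit_trans[OF P C(1,4,3,6)] by blast
  qed
qed

lemma component_closed:
  assumes P: "oriented_matroid P" and C: "C \<in> matroid_circuits P"
    and y: "y \<in> C" "y = p \<or> (\<exists>C\<in>matroid_circuits P. p \<in> C \<and> y \<in> C)" and x: "x \<in> C"
  shows "x = p \<or> (\<exists>C\<in>matroid_circuits P. p \<in> C \<and> x \<in> C)"
proof (cases "y = p")
  case True
  then show ?thesis using C y x by blast
next
  case False
  then obtain C' where C': "C' \<in> matroid_circuits P" "p \<in> C'" "y \<in> C'" using y(2) by blast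
  then show ?thesis using matroid_common_circuit_trans[OF P C'(1) C C'(2) x] y(1) by blast
qed

text \<open>Contract the component \<open>?K\<close> of \<open>p\<close> and take \<open>x\<close>
  outside it. A positive cocircuit off \<open>?K\<close> would miss \<open>p\<close>. A circuit
  through \<open>x\<close> with negative elements only in \<open>?K\<close> is either positive,
  against acyclicity, or it joins \<open>x\<close> to the component.\<close>

lemma bounded_connected:
  assumes P: "oriented_matroid P" and b: "bounded_wrt P p"
  shows "matroid_connected P" "\<not> is_loop P"
proof -
  have p: "p \<in> ground P" and acyc: "positive_circuits P = {}"
    and pD: "\<And>D. D \<in> positive_cocircuits P \<Longrightarrow> p \<in> D"
    using b by (auto simp: bounded_wrt_def om_acyclic_def)
  show "\<not> is_loop P"
  proof
    assume "is_loop P"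
    then obtain e where e: "{e} \<in> matroid_circuits P" unfolding is_loop_def by blast
    then obtain X where X: "X \<in> circuits P" "supp X = {e}" "e \<in> fst X"
      using om_orient_at[OF P, of _ e] unfolding matroid_circuits_iff by (metis singletonI)
    then have "X = ({e}, {})"
      using om_circuit(1)[OF P X(1)] unfolding supp_def prod_eq_iff by auto
    then show False using X(1) acyc positive_circuits_iff[of "{e}" P] by simp
  qed
  show "matroid_connected P"
  proof (rule matroid_connected_via[OF P p], rule ccontr)
    let ?K = "{y \<in> ground P. y = p \<or> (\<exists>C\<in>matroid_circuits P. p \<in> C \<and> y \<in> C)}"
    fix x assume x: "x \<in> ground P" "x \<noteq> p" "\<not> (\<exists>C\<in>matroid_circuits P. p \<in> C \<and> x \<in> C)"
    then have xK: "x \<notin> ?K" by blast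
    have K: "?K \<subseteq> ground P" by blast
    from farkas_contract[OF P K x(1) xK] show False
    proof (elim disjE bexE conjE)
      fix Z assume Z: "Z \<in> circuits P" "x \<in> fst Z" "snd Z \<subseteq> ?K"
      show False
      proof (cases "snd Z = {}")
        case True
        then have "Z = (fst Z, {})" by (simp add: prod_eq_iff)
        then have "(fst Z, {}) \<in> circuits P" using Z(1) by metis
        then show False using acyc positive_circuits_iff by blast
      next
        case False
        then obtain y where y: "y \<in> snd Z" by blast
        have "supp Z \<in> matroid_circuits P" using Z(1) matroid_circuits_iff by metis
        from component_closed[OF P this, of y p x] show False
          using y Z(2,3) x unfolding supp_def by blast
      qed
    next
      fix D assume D: "D \<in> positive_cocircuits P" "D \<inter> ?K = {}"
      then show False using pD[OF D(1)] p by blast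
    qed
  qed
qed

lemma dual_bounded_connected:
  assumes P: "oriented_matroid P" and b: "dual_bounded_wrt P p"
  shows "matroid_connected P" "\<not> is_isthmus P"
proof -
  have p: "p \<in> ground P" and cyc: "positive_cocircuits P = {}"
    and pC: "\<And>C. C \<in> positive_circuits P \<Longrightarrow> p \<in> C"
    using b by (auto simp: dual_bounded_wrt_def totally_cyclic_def)
  have ex: "\<exists>C\<in>positive_circuits P. x \<in> C" if x: "x \<in> ground P" for x
  proof -
    obtain Z where Z: "Z \<in> circuits P" "x \<in> fst Z" "snd Z \<subseteq> {}"
      using farkas_contract[OF P empty_subsetI x] cyc by blast
    then have "Z = (fst Z, {})" by (simp add: prod_eq_iff)
    then have "(fst Z, {}) \<in> circuits P" using Z(1) by metis
    then show ?thesis using Z(2) positive_circuits_iff by blast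
  qed
  have mc: "C \<in> matroid_circuits P" if "C \<in> positive_circuits P" for C
    using that by (auto simp: positive_circuits_def matroid_circuits_def)
  show "matroid_connected P"
    by (rule matroid_connected_via[OF P p]) (use ex mc pC in blast)
  show "\<not> is_isthmus P"
  proof
    assume "is_isthmus P"
    then obtain e where e: "ground P = {e}" "{e} \<in> matroid_cocircuits P"
      unfolding is_isthmus_def by blast
    obtain C where C: "C \<in> positive_circuits P" "e \<in> C" using ex e(1) by blast
    then have "C \<inter> {e} = {e}" by blast
    then show False using circuit_cocircuit_not_single[OF P e(2) mc[OF C(1)]] by blast
  qed
qed

subsection \<open>The minors of the active filtration\<close>

lemma active_minor_bounded:
  fixes N :: "'a::linorder omatroid"
  assumes N: "oriented_matroid N" and p: "p \<in> dual_active N"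
  defines "F \<equiv> ground N - \<Union> {D \<in> positive_cocircuits N. p < Min D}"
    and "G \<equiv> ground N - \<Union> {D \<in> positive_cocircuits N. p \<le> Min D}"
  shows "G \<subset> F" "Min (F - G) = p" "bounded_wrt (minor N F G) p"
proof -
  have finG: "finite G" "finite F" using om_finite[OF N] unfolding G_def F_def by simp_all
  obtain D0 where D0: "D0 \<in> positive_cocircuits N" "p = Min D0"
    using p unfolding dual_active_def by blast
  note pc = positive_cocircuit[OF N]
  have Min_le: "Min D \<le> y" if "D \<in> positive_cocircuits N" "y \<in> D" for D y
    using pc(3)[OF that(1)] that(2) by simp
  have "p \<in> D0" using D0 pc[OF D0(1)] by (metis Min_in)
  then have pG: "p \<in> ground N" "p \<notin> G" using D0 pc(1)[OF D0(1)] unfolding G_def by blast+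
  have pF: "p \<in> F" using pG(1) Min_le unfolding F_def by (auto simp: leD)
  have "G \<subseteq> F" unfolding F_def G_def by force
  then show "G \<subset> F" using pG pF by blast
  have ge: "p \<le> y" if "y \<in> F - G" for y
  proof -
    have "y \<in> ground N" "y \<notin> G" using that unfolding F_def by blast+
    then obtain D where "D \<in> positive_cocircuits N" "p \<le> Min D" "y \<in> D" unfolding G_def by blast
    then show ?thesis using Min_le order_trans by blast
  qed
  show "Min (F - G) = p"
    by (rule Min_eqI) (use finG ge pF pG in auto)
  let ?P = "minor N F G"
  have P: "oriented_matroid ?P" by (rule om_minor[OF N finG(1)])
  show "bounded_wrt ?P p"
    unfolding bounded_wrt_def om_acyclic_def
  proof (intro conjI ballI)
    show "p \<in> ground ?P" using pF pG by simp
    show "positive_circuits ?P = {}"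
    proof (rule ccontr)
      assume "positive_circuits ?P \<noteq> {}"
      then obtain C where "C \<in> positive_circuits ?P" by blast
      then obtain Z where Z: "Z \<in> circuits N" "supp Z \<subseteq> F" "snd Z \<subseteq> G" "fst Z - G \<noteq> {}"
        using minor_positive_circuitE[OF N finG(1)] by metis
      then obtain x where x: "x \<in> fst Z" "x \<notin> G" by blast
      moreover have "x \<in> ground N" using om_circuit(2)[OF N Z(1)] x(1) unfolding supp_def by blast
      ultimately obtain D where D: "D \<in> positive_cocircuits N" "p \<le> Min D" "x \<in> D"
        unfolding G_def by blast
      then have "D \<inter> G = {}" unfolding G_def by blast
      then have "supp Z \<inter> D = {}" using positive_cocircuit_orth[OF D(1) Z(1)] Z(3) by blast
      then show False using x(1) D(3) unfolding supp_def by blast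
    qed
    fix D' assume D': "D' \<in> positive_cocircuits ?P"
    have D'_sub: "D' \<subseteq> ground N \<inter> F - G" using positive_cocircuit(1)[OF P D'] by simp
    show "p \<in> D'"
    proof (rule ccontr)
      assume pD': "p \<notin> D'"
      obtain x where x: "x \<in> D'" using positive_cocircuit(2)[OF P D'] by blast
      \<comment> \<open>The choice makes both alternatives fail. A circuit negative only on
        \<open>F - D'\<close> stays inside \<open>F\<close>, by orthogonality to the cocircuits
        removed from it, and contradicts orthogonality to \<open>D'\<close>. A positive cocircuit
        off \<open>F - D'\<close> has all elements above \<open>p\<close>, hence avoids
        \<open>F\<close>, although \<open>x\<close> is in \<open>F\<close>.\<close>
      have L: "F - D' \<subseteq> ground N" unfolding F_def by blast
      have "x \<in> ground N" "x \<notin> F - D'" using x D'_sub by blast+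
      from farkas_contract[OF N L this] show False
      proof (elim disjE bexE conjE)
        fix Z assume Z: "Z \<in> circuits N" "x \<in> fst Z" "snd Z \<subseteq> F - D'"
        have "supp Z \<inter> D = {}" if D: "D \<in> positive_cocircuits N" "p < Min D" for D
        proof -
          have "D \<inter> F = {}" using D unfolding F_def by blast
          then show ?thesis using positive_cocircuit_orth[OF D(1) Z(1)] Z(3) by blast
        qed
        then have "supp Z \<subseteq> F" using om_circuit(2)[OF N Z(1)] unfolding F_def by blast
        then have "supp Z \<inter> D' = {}"
          using minor_positive_cocircuit_orth[OF N finG(1) D' Z(1)] Z(3) by blast
        then show False using x Z(2) unfolding supp_def by blast
      next
        fix D assume D: "D \<in> positive_cocircuits N" "x \<in> D" "D \<inter> (F - D') = {}"
        have "p < y" if y: "y \<in> D" for y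
        proof (cases "y \<in> D'")
          case True
          then have "p \<le> y" using ge D'_sub by blast
          then show ?thesis using True pD' by (metis order_le_less)
        next
          case False
          then have "y \<notin> F" "y \<in> ground N" using y D(3) pc(1)[OF D(1)] by blast+
          then obtain D2 where "D2 \<in> positive_cocircuits N" "p < Min D2" "y \<in> D2"
            unfolding F_def by blast
          then show ?thesis using Min_le order_less_le_trans by blast
        qed
        then have "p < Min D" using pc[OF D(1)] by simp
        then have "x \<notin> F" using D unfolding F_def by blast
        then show False using x D'_sub by blast
      qed
    qed
  qed
qed

lemma active_minor_dual_bounded:
  fixes N :: "'a::linorder omatroid"
  assumes N: "oriented_matroid N" and p: "p \<in> active N"
  defines "F \<equiv> \<Union> {C \<in> positive_circuits N. p \<le> Min C}"
    and "G \<equiv> \<Union> {C \<in> positive_circuits N. p < Min C}"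
  shows "G \<subset> F" "Min (F - G) = p" "dual_bounded_wrt (minor N F G) p"
proof -
  note pc = positive_circuit[OF N]
  have sub: "F \<subseteq> ground N" "G \<subseteq> ground N" using pc(1) unfolding F_def G_def by blast+
  then have finG: "finite G" "finite F" using om_finite[OF N] by (meson finite_subset)+
  obtain C0 where C0: "C0 \<in> positive_circuits N" "p = Min C0"
    using p unfolding active_def by blast
  have Min_le: "Min C \<le> y" if "C \<in> positive_circuits N" "y \<in> C" for C y
    using pc(3)[OF that(1)] that(2) by simp
  have "p \<in> C0" using C0 pc[OF C0(1)] by (metis Min_in)
  then have pF: "p \<in> F" using C0 unfolding F_def by blast
  have G_gt: "p < y" if "y \<in> G" for y
    using that Min_le order_less_le_trans unfolding G_def by blast
  have F_ge: "p \<le> y" if "y \<in> F" for y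
    using that Min_le order_trans unfolding F_def by blast
  have pG: "p \<notin> G" using G_gt by blast
  have "G \<subseteq> F" unfolding F_def G_def by force
  then show "G \<subset> F" using pG pF by blast
  show "Min (F - G) = p"
    by (rule Min_eqI) (use finG F_ge pF pG in auto)
  let ?P = "minor N F G"
  have P: "oriented_matroid ?P" by (rule om_minor[OF N finG(1)])
  show "dual_bounded_wrt ?P p"
    unfolding dual_bounded_wrt_def totally_cyclic_def
  proof (intro conjI ballI)
    show "p \<in> ground ?P" using pF pG sub by auto
    show "positive_cocircuits ?P = {}"
    proof (rule ccontr)
      assume "positive_cocircuits ?P \<noteq> {}"
      then obtain D where D: "D \<in> positive_cocircuits ?P" by blast
      obtain y where y: "y \<in> D" using positive_cocircuit(2)[OF P D] by blast
      then have "y \<in> F" using positive_cocircuit(1)[OF P D] by auto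
      then obtain C where C: "C \<in> positive_circuits N" "p \<le> Min C" "y \<in> C" unfolding F_def by blast
      then have "(C, {}) \<in> circuits N" "supp (C, {}) \<subseteq> F"
        unfolding F_def by (auto simp: positive_circuits_iff supp_def)
      then have "supp (C, {}) \<inter> D = {}" using minor_positive_cocircuit_orth[OF N finG(1) D] by simp
      then show False using C(3) y by (auto simp: supp_def)
    qed
    fix X assume X: "X \<in> positive_circuits ?P"
    obtain Z where Z: "Z \<in> circuits N" "supp Z \<subseteq> F" "snd Z \<subseteq> G" "X = fst Z - G" "X \<noteq> {}"
      using minor_positive_circuitE[OF N finG(1) X] .
    show "p \<in> X"
    proof (rule ccontr)
      assume pX: "p \<notin> X"
      obtain x where x: "x \<in> X" using Z(5) by blast
      have XF: "X \<subseteq> F" using Z(2,4) unfolding supp_def by blast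
      \<comment> \<open>A positive circuit inside \<open>X \<union> G\<close> has all elements above
        \<open>p\<close>, so it lies in \<open>G\<close>, but \<open>x\<close> does not. A cocircuit
        nonnegative on \<open>X \<union> G\<close> misses \<open>G\<close>, a union of positive
        circuits; it then agrees with \<open>Z\<close> at \<open>x\<close> and disagrees with it
        nowhere.\<close>
      then have B: "X \<union> G \<subseteq> ground N" "x \<in> X \<union> G" using x sub by blast+
      from farkas_restrict[OF N B] show False
      proof (elim disjE bexE conjE)
        fix C assume C: "C \<in> positive_circuits N" "x \<in> C" "C \<subseteq> X \<union> G"
        have "p < y" if y: "y \<in> C" for y
        proof (cases "y \<in> G")
          case False
          then have "y \<in> X" using y C(3) by blast
          then show ?thesis using F_ge XF pX by (metis order_le_less subsetD)
        qed (rule G_gt)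
        then have "p < Min C" using pc[OF C(1)] by simp
        then show False using C x Z(4) unfolding G_def by blast
      next
        fix Y assume Y: "Y \<in> cocircuits N" "x \<in> fst Y" "snd Y \<inter> (X \<union> G) = {}"
        have "supp Y \<inter> C = {}" if C: "C \<in> positive_circuits N" "p < Min C" for C
        proof -
          have "C \<subseteq> G" using C unfolding G_def by blast
          then show ?thesis using positive_circuit_orth[OF C(1) Y(1)] Y(3) by blast
        qed
        then have YG: "supp Y \<inter> G = {}" unfolding G_def by blast
        have "orthogonal Z Y" using Y(1) Z(1) by (simp add: cocircuits_def)
        moreover have "x \<in> supp Z \<inter> supp Y" using x Z(4) Y(2) unfolding supp_def by blast
        moreover have "fst Z \<inter> snd Y = {}" using Z(4) Y(3) by blast
        moreover have "snd Z \<inter> fst Y = {}" using Z(3) YG unfolding supp_def by blast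
        ultimately show False unfolding orthogonal_def by blast
      qed
    qed
  qed
qed

subsection \<open>Recovering the active filtration from a filtration with bounded minors\<close>

text \<open>Takes the first index where \<open>P\<close> holds. It locates the level of a chain at
  which an element, a circuit or a cocircuit crosses it.\<close>

lemma step_between:
  fixes j n :: nat
  assumes "\<not> P j" "P n" "j \<le> n"
  obtains k where "j < k" "k \<le> n" "\<not> P (k - 1)" "P k"
proof -
  let ?k = "LEAST k. j \<le> k \<and> P k"
  have k: "j \<le> ?k" "P ?k" using LeastI[of "\<lambda>k. j \<le> k \<and> P k" n] assms(2,3) by simp_all
  have "?k \<le> n" using Least_le[of "\<lambda>k. j \<le> k \<and> P k" n] assms(2,3) by simp
  moreover have jk: "j < ?k" using k assms(1) by (metis order_le_less)
  moreover have "\<not> P (?k - 1)" using not_less_Least[of "?k - 1" "\<lambda>k. j \<le> k \<and> P k"] jk by auto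
  ultimately show ?thesis using that k(2) by blast
qed

text \<open>The acyclic half of a filtration, with the list read as a function. Nothing ties
  \<open>F 0\<close> to the positive circuits yet: that the positive cocircuits avoid it is supplied
  by the other half, as the assumption \<open>D0\<close> below.\<close>

locale bounded_chain =
  fixes N :: "'a::linorder omatroid" and F :: "nat \<Rightarrow> 'a set" and n :: nat and p :: "nat \<Rightarrow> 'a"
  assumes N: "oriented_matroid N"
    and top: "F n = ground N"
    and step: "\<And>k. k \<in> {1..n} \<Longrightarrow> F (k - 1) \<subset> F k"
    and p: "\<And>k. k \<in> {1..n} \<Longrightarrow> p k = Min (F k - F (k - 1))"
    and p_mono: "strict_mono_on {1..n} p"
    and bounded: "\<And>k. k \<in> {1..n} \<Longrightarrow> bounded_wrt (minor N (F k) (F (k - 1))) (p k)"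
begin

lemma mono: "i \<le> j \<Longrightarrow> j \<le> n \<Longrightarrow> F i \<subseteq> F j"
proof (induction j rule: dec_induct)
  case (step j)
  then show ?case using step.IH bounded_chain.step[OF bounded_chain_axioms, of "Suc j"] by auto
qed simp

lemma finite_F: "k \<le> n \<Longrightarrow> finite (F k)"
  using mono[of k n] top om_finite[OF N] by (metis finite_subset order_refl)

text \<open>The element \<open>y\<close> enters the chain at some level \<open>j\<close> \<ge>
  \<open>k\<close>, where it is at least \<open>p j\<close>, and \<open>p\<close> is
  increasing.\<close>

lemma p_le:
  assumes "k \<in> {1..n}" "y \<in> ground N" "y \<notin> F (k - 1)"
  shows "p k \<le> y"
proof -
  have "k - 1 \<le> n" "y \<in> F n" using assms top by auto
  then obtain j where j: "k - 1 < j" "j \<le> n" "y \<notin> F (j - 1)" "y \<in> F j"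
    using step_between[of "\<lambda>k. y \<in> F k" "k - 1" n] assms(3) by metis
  then have "j \<in> {1..n}" "k \<le> j" by auto
  then have "p k \<le> p j" using p_mono assms(1) by (metis strict_mono_on_leD)
  also have "p j \<le> y" using p[OF \<open>j \<in> {1..n}\<close>] finite_F[OF j(2)] j(3,4) by simp
  finally show ?thesis .
qed

lemma p_in: "k \<in> {1..n} \<Longrightarrow> p k \<in> F k - F (k - 1)"
  using bounded[of k] by (auto simp: bounded_wrt_def)

text \<open>Expresses that contracting \<open>F k\<close> leaves an acyclic matroid. At the level
  where \<open>Z\<close> is exhausted, its trace would contain a positive circuit of the
  minor.\<close>

lemma face:
  assumes Z: "Z \<in> circuits N" "snd Z \<subseteq> F k" and k: "k \<le> n"
  shows "supp Z \<subseteq> F k"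
proof (rule ccontr)
  assume "\<not> supp Z \<subseteq> F k"
  moreover have "supp Z \<subseteq> F n" using om_circuit(2)[OF N Z(1)] top by simp
  ultimately obtain j where j: "k < j" "j \<le> n" "\<not> supp Z \<subseteq> F (j - 1)" "supp Z \<subseteq> F j"
    using step_between[of "\<lambda>k. supp Z \<subseteq> F k" k n] k by metis
  then obtain x where x: "x \<in> supp Z - F (j - 1)" by blast
  have "k \<le> j - 1" "j - 1 \<le> n" using j by auto
  then have "snd Z \<subseteq> F (j - 1)" using Z(2) mono by blast
  moreover have "finite (F (j - 1))" using finite_F j(2) by simp
  ultimately obtain C where "C \<in> positive_circuits (minor N (F j) (F (j - 1)))"
    using minor_positive_trace[OF N _ Z(1) j(4) _ x] by metis
  then show False using bounded[of j] j(1,2) by (auto simp: bounded_wrt_def om_acyclic_def)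
qed

lemma positive_circuit_bottom:
  assumes "C \<in> positive_circuits N"
  shows "C \<subseteq> F 0"
  using face[of "(C, {})" 0] assms by (simp add: positive_circuits_iff supp_def)

text \<open>Let \<open>k\<close> be the level where \<open>D\<close> first meets the chain. All
  positive cocircuits of that minor contain \<open>p k\<close>, so each other element lies on a
  circuit of the minor that is positive there and negative at most at \<open>p k\<close>. If
  \<open>D\<close> missed \<open>p k\<close>, a lift of this circuit would have no negative element
  on \<open>D\<close> and yet meet it.\<close>

lemma positive_cocircuit_Min:
  assumes D: "D \<in> positive_cocircuits N" and D0: "D \<inter> F 0 = {}"
  obtains k where "k \<in> {1..n}" "Min D = p k" "D \<inter> F (k - 1) = {}"
proof -
  have "D \<inter> F n \<noteq> {}" using positive_cocircuit[OF N D] top by auto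
  then obtain k where k: "0 < k" "k \<le> n" "D \<inter> F (k - 1) = {}" "D \<inter> F k \<noteq> {}"
    using step_between[of "\<lambda>k. D \<inter> F k \<noteq> {}" 0 n] D0 by auto
  then have kn: "k \<in> {1..n}" by simp
  let ?P = "minor N (F k) (F (k - 1))"
  have P: "oriented_matroid ?P" using om_minor[OF N] finite_F k(2) by simp
  have "p k \<in> D"
  proof (rule ccontr)
    assume pD: "p k \<notin> D"
    obtain x where x: "x \<in> D" "x \<in> F k" using k(4) by blast
    then have xP: "x \<in> ground ?P" "x \<notin> {p k}"
      using k(3) pD positive_cocircuit(1)[OF N D] by auto
    have pP: "{p k} \<subseteq> ground ?P" using bounded[OF kn] by (simp add: bounded_wrt_def)
    have "D' \<inter> {p k} \<noteq> {}" if "D' \<in> positive_cocircuits ?P" for D'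
      using bounded[OF kn] that by (simp add: bounded_wrt_def)
    then obtain X where X: "X \<in> circuits ?P" "x \<in> fst X" "snd X \<subseteq> {p k}"
      using farkas_contract[OF P pP xP] by metis
    obtain Z where Z: "Z \<in> circuits N" "fst X = fst Z - F (k - 1)" "snd X = snd Z - F (k - 1)"
      using minor_circuitE[OF X(1)] by metis
    have "snd Z \<inter> D = {}" using X(3) Z(3) pD k(3) by blast
    then have "supp Z \<inter> D = {}" by (rule positive_cocircuit_orth[OF D Z(1)])
    then show False using X(2) Z(2) x(1) unfolding supp_def by blast
  qed
  moreover have "p k \<le> y" if "y \<in> D" for y
    using p_le[OF kn] that k(3) positive_cocircuit(1)[OF N D] by blast
  ultimately have "Min D = p k" using positive_cocircuit(3)[OF N D] by (metis Min_eqI)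
  then show ?thesis using that kn k(3) by blast
qed

text \<open>By \<open>face\<close>, a circuit negative only on \<open>F k\<close> cannot reach
  \<open>x\<close>, which leaves the other alternative.\<close>

lemma positive_cocircuit_avoiding:
  assumes "k \<le> n" "x \<in> ground N" "x \<notin> F k"
  obtains D where "D \<in> positive_cocircuits N" "x \<in> D" "D \<inter> F k = {}"
proof -
  have "F k \<subseteq> ground N" using mono[of k n] assms(1) top by simp
  moreover have False if Z: "Z \<in> circuits N" "x \<in> fst Z" "snd Z \<subseteq> F k" for Z
    using face[OF Z(1,3) assms(1)] Z(2) assms(3) unfolding supp_def by blast
  ultimately show ?thesis using farkas_contract[OF N _ assms(2,3)] that by blast
qed

lemma dual_active_eq:
  assumes D0: "\<And>D. D \<in> positive_cocircuits N \<Longrightarrow> D \<inter> F 0 = {}"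
  shows "dual_active N = p ` {1..n}"
proof (intro equalityI subsetI)
  fix a assume "a \<in> dual_active N"
  then obtain D where D: "D \<in> positive_cocircuits N" "a = Min D" unfolding dual_active_def by blast
  then show "a \<in> p ` {1..n}" using positive_cocircuit_Min[OF D(1) D0[OF D(1)]] by blast
next
  fix a assume "a \<in> p ` {1..n}"
  then obtain k where k: "k \<in> {1..n}" "a = p k" by blast
  have "p k \<in> ground N" using p_in[OF k(1)] mono[of k n] top k(1) by auto
  moreover have "k - 1 \<le> n" using k(1) by auto
  ultimately obtain D where D: "D \<in> positive_cocircuits N" "p k \<in> D" "D \<inter> F (k - 1) = {}"
    using positive_cocircuit_avoiding[of "k - 1" "p k"] p_in[OF k(1)] by blast
  have "Min D = p k"
  proof (rule Min_eqI)
    show "finite D" "p k \<in> D" using positive_cocircuit(3)[OF N D(1)] D(2) by simp_all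
    show "p k \<le> y" if "y \<in> D" for y
      using p_le[OF k(1)] that D(3) positive_cocircuit(1)[OF N D(1)] by blast
  qed
  then show "a \<in> dual_active N" using D(1) k(2) unfolding dual_active_def by (metis image_eqI)
qed

lemma F_eq:
  assumes D0: "\<And>D. D \<in> positive_cocircuits N \<Longrightarrow> D \<inter> F 0 = {}" and k: "k \<in> {1..n}"
  shows "ground N - \<Union> {D \<in> positive_cocircuits N. p k \<le> Min D} = F (k - 1)"
proof (intro equalityI subsetI)
  fix x assume x: "x \<in> F (k - 1)"
  have "x \<notin> D" if D: "D \<in> positive_cocircuits N" "p k \<le> Min D" for D
  proof -
    obtain j where j: "j \<in> {1..n}" "Min D = p j" "D \<inter> F (j - 1) = {}"
      using positive_cocircuit_Min[OF D(1) D0[OF D(1)]] .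
    have "k \<le> j"
    proof (rule ccontr)
      assume "\<not> k \<le> j"
      then have "p j < p k" using p_mono j(1) k by (auto simp: strict_mono_on_def)
      then show False using D(2) j(2) by simp
    qed
    then have "k - 1 \<le> j - 1" "j - 1 \<le> n" using j(1) by auto
    then have "F (k - 1) \<subseteq> F (j - 1)" by (rule mono)
    then show ?thesis using x j(3) by blast
  qed
  moreover have "k - 1 \<le> n" using k by auto
  then have "x \<in> ground N" using x mono[of "k - 1" n] top by blast
  ultimately show "x \<in> ground N - \<Union> {D \<in> positive_cocircuits N. p k \<le> Min D}" by blast
next
  fix x assume x: "x \<in> ground N - \<Union> {D \<in> positive_cocircuits N. p k \<le> Min D}"
  show "x \<in> F (k - 1)"
  proof (rule ccontr)
    assume "x \<notin> F (k - 1)"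
    moreover have "k - 1 \<le> n" "x \<in> ground N" using k x by auto
    ultimately obtain D where D: "D \<in> positive_cocircuits N" "x \<in> D" "D \<inter> F (k - 1) = {}"
      using positive_cocircuit_avoiding by blast
    have "p k \<le> Min D"
      using p_le[OF k] D(3) positive_cocircuit[OF N D(1)] by (metis Min_in disjoint_iff subsetD)
    then show False using D x by blast
  qed
qed

end

text \<open>The cyclic half. Indices run against inclusion, as in the list of primed sets, so
  inductions start at the empty set \<open>F n\<close>.\<close>

locale dual_bounded_chain =
  fixes N :: "'a::linorder omatroid" and F :: "nat \<Rightarrow> 'a set" and n :: nat and p :: "nat \<Rightarrow> 'a"
  assumes N: "oriented_matroid N"
    and bottom: "F n = {}"
    and sub_ground: "F 0 \<subseteq> ground N"
    and step: "\<And>k. k \<in> {1..n} \<Longrightarrow> F k \<subset> F (k - 1)"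
    and p: "\<And>k. k \<in> {1..n} \<Longrightarrow> p k = Min (F (k - 1) - F k)"
    and p_mono: "strict_mono_on {1..n} p"
    and dual_bounded: "\<And>k. k \<in> {1..n} \<Longrightarrow> dual_bounded_wrt (minor N (F (k - 1)) (F k)) (p k)"
begin

lemma antimono: "i \<le> j \<Longrightarrow> j \<le> n \<Longrightarrow> F j \<subseteq> F i"
proof (induction j rule: dec_induct)
  case (step j)
  then show ?case using step.IH dual_bounded_chain.step[OF dual_bounded_chain_axioms, of "Suc j"] by auto
qed simp

lemma F_ground: "k \<le> n \<Longrightarrow> F k \<subseteq> ground N"
  using antimono[of 0 k] sub_ground by blast

lemma finite_F: "k \<le> n \<Longrightarrow> finite (F k)"
  using F_ground om_finite[OF N] by (meson finite_subset)

lemma p_le: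
  assumes "k \<in> {1..n}" "y \<in> F (k - 1)"
  shows "p k \<le> y"
proof -
  have "k - 1 \<le> n" "y \<notin> F n" using assms bottom by auto
  then obtain j where j: "k - 1 < j" "j \<le> n" "y \<in> F (j - 1)" "y \<notin> F j"
    using step_between[of "\<lambda>k. y \<notin> F k" "k - 1" n] assms(2) by metis
  then have "j \<in> {1..n}" "k \<le> j" by auto
  then have "p k \<le> p j" using p_mono assms(1) by (metis strict_mono_on_leD)
  also have "p j \<le> y" using p[OF \<open>j \<in> {1..n}\<close>] finite_F[of "j - 1"] j by simp
  finally show ?thesis .
qed

lemma p_in: "k \<in> {1..n} \<Longrightarrow> p k \<in> F (k - 1) - F k"
  using dual_bounded[of k] by (auto simp: dual_bounded_wrt_def)

lemma minor_positive_circuit_ex: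
  assumes k: "k \<in> {1..n}" and x: "x \<in> F (k - 1) - F k"
  obtains X where "X \<in> positive_circuits (minor N (F (k - 1)) (F k))" "x \<in> X"
proof -
  let ?P = "minor N (F (k - 1)) (F k)"
  have P: "oriented_matroid ?P" using om_minor[OF N] finite_F k by simp
  have "k - 1 \<le> n" using k by auto
  then have "x \<in> ground ?P" using x F_ground by auto
  moreover have "positive_cocircuits ?P = {}"
    using dual_bounded[OF k] by (simp add: dual_bounded_wrt_def totally_cyclic_def)
  ultimately obtain Z where Z: "Z \<in> circuits ?P" "x \<in> fst Z" "snd Z \<subseteq> {}"
    using farkas_contract[OF P empty_subsetI, of x] by blast
  then have "Z = (fst Z, {})" by (simp add: prod_eq_iff)
  then have "fst Z \<in> positive_circuits ?P" using Z(1) positive_circuits_iff by metis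
  then show ?thesis using that Z(2) by blast
qed

text \<open>A positive circuit of the minor lifts only to a circuit \<open>Z\<close> that may be
  negative on \<open>F (Suc k)\<close>. If no positive circuit inside \<open>F k\<close> passed
  through \<open>x\<close>, some cocircuit \<open>Y\<close> would be positive at \<open>x\<close>
  and nonnegative on \<open>F k\<close>. By induction \<open>F (Suc k)\<close> is a union of
  positive circuits, so \<open>Y\<close> misses it and never disagrees with
  \<open>Z\<close>.\<close>

lemma positive_circuit_through:
  assumes "k \<le> n" "x \<in> F k"
  shows "\<exists>C\<in>positive_circuits N. x \<in> C \<and> C \<subseteq> F k"
  using assms
proof (induction "n - k" arbitrary: k x)
  case 0
  then show ?case using bottom by simp
next
  case (Suc d)
  then have k: "Suc k \<in> {1..n}" and IH: "\<And>y. y \<in> F (Suc k) \<Longrightarrow>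
      \<exists>C\<in>positive_circuits N. y \<in> C \<and> C \<subseteq> F (Suc k)" by auto
  have sub: "F (Suc k) \<subseteq> F k" using step[OF k] by auto
  show ?case
  proof (cases "x \<in> F (Suc k)")
    case True
    then obtain C where "C \<in> positive_circuits N" "x \<in> C" "C \<subseteq> F (Suc k)" using IH by metis
    then show ?thesis using sub by (intro bexI[of _ C]) auto
  next
    case False
    then obtain X where X: "X \<in> positive_circuits (minor N (F k) (F (Suc k)))" "x \<in> X"
      using minor_positive_circuit_ex[OF k, of x] Suc.prems by auto
    obtain Z where Z: "Z \<in> circuits N" "supp Z \<subseteq> F k" "snd Z \<subseteq> F (Suc k)" "X = fst Z - F (Suc k)"
      using minor_positive_circuitE[OF N finite_F X(1)] k by (metis atLeastAtMost_iff)
    show ?thesis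
    proof (rule ccontr)
      assume "\<not> ?thesis"
      then obtain Y where Y: "Y \<in> cocircuits N" "x \<in> fst Y" "snd Y \<inter> F k = {}"
        using farkas_restrict[OF N F_ground[OF Suc.prems(1)] Suc.prems(2)] by blast
      have YF: "supp Y \<inter> F (Suc k) = {}"
      proof (rule ccontr)
        assume "supp Y \<inter> F (Suc k) \<noteq> {}"
        then obtain y where y: "y \<in> supp Y" "y \<in> F (Suc k)" by blast
        then obtain C where C: "C \<in> positive_circuits N" "y \<in> C" "C \<subseteq> F (Suc k)"
          using IH by blast
        have "supp Y \<inter> C = {}" using positive_circuit_orth[OF C(1) Y(1)] Y(3) C(3) sub by blast
        then show False using y C(2) by blast
      qed
      have "orthogonal Z Y" using Y(1) Z(1) by (simp add: cocircuits_def)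
      moreover have "x \<in> supp Z \<inter> supp Y" using X(2) Z(4) Y(2) unfolding supp_def by blast
      moreover have "fst Z \<inter> snd Y = {}" using Z(2) Y(3) unfolding supp_def by blast
      moreover have "snd Z \<inter> fst Y = {}" using Z(3) YF unfolding supp_def by blast
      ultimately show False unfolding orthogonal_def by blast
    qed
  qed
qed

lemma positive_cocircuit_disjoint:
  assumes D: "D \<in> positive_cocircuits N"
  shows "D \<inter> F 0 = {}"
proof (rule ccontr)
  assume "D \<inter> F 0 \<noteq> {}"
  then obtain x C where C: "C \<in> positive_circuits N" "x \<in> C" "x \<in> D"
    using positive_circuit_through[of 0] by blast
  then have "(C, {}) \<in> circuits N" by (simp add: positive_circuits_iff)
  from positive_cocircuit_orth[OF D this] show False using C by (auto simp: supp_def)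
qed

text \<open>At the last level containing \<open>C\<close>, its nonempty trace contains a positive
  circuit of the minor, and that circuit contains \<open>p k\<close>.\<close>

lemma positive_circuit_Min:
  assumes C: "C \<in> positive_circuits N" and C0: "C \<subseteq> F 0"
  obtains k where "k \<in> {1..n}" "Min C = p k" "C \<subseteq> F (k - 1)"
proof -
  have "\<not> C \<subseteq> F n" using positive_circuit(2)[OF N C] bottom by auto
  then obtain k where k: "0 < k" "k \<le> n" "C \<subseteq> F (k - 1)" "\<not> C \<subseteq> F k"
    using step_between[of "\<lambda>k. \<not> C \<subseteq> F k" 0 n] C0 by auto
  then have kn: "k \<in> {1..n}" by simp
  obtain x where x: "x \<in> C" "x \<notin> F k" using k(4) by blast
  have Z: "(C, {}) \<in> circuits N" using C by (simp add: positive_circuits_iff)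
  have "supp (C, {}) \<subseteq> F (k - 1)" "snd (C, {}) \<subseteq> F k" "x \<in> supp (C, {}) - F k"
    using k(3) x by (simp_all add: supp_def)
  then obtain X where X: "X \<in> positive_circuits (minor N (F (k - 1)) (F k))" "X \<subseteq> supp (C, {})"
    using minor_positive_trace[OF N finite_F[OF k(2)] Z] by metis
  then have "p k \<in> C" using dual_bounded[OF kn] by (auto simp: dual_bounded_wrt_def supp_def)
  moreover have "p k \<le> y" if "y \<in> C" for y using p_le[OF kn] that k(3) by blast
  ultimately have "Min C = p k" using positive_circuit(3)[OF N C] by (metis Min_eqI)
  then show ?thesis using that kn k(3) by blast
qed

lemma active_eq:
  assumes C0: "\<And>C. C \<in> positive_circuits N \<Longrightarrow> C \<subseteq> F 0"
  shows "active N = p ` {1..n}"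
proof (intro equalityI subsetI)
  fix a assume "a \<in> active N"
  then obtain C where C: "C \<in> positive_circuits N" "a = Min C" unfolding active_def by blast
  then show "a \<in> p ` {1..n}" using positive_circuit_Min[OF C(1) C0[OF C(1)]] by blast
next
  fix a assume "a \<in> p ` {1..n}"
  then obtain k where k: "k \<in> {1..n}" "a = p k" by blast
  then have "k - 1 \<le> n" by auto
  then obtain C where C: "C \<in> positive_circuits N" "p k \<in> C" "C \<subseteq> F (k - 1)"
    using positive_circuit_through[of "k - 1" "p k"] p_in[OF k(1)] by blast
  have "Min C = p k"
    by (rule Min_eqI) (use positive_circuit(3)[OF N C(1)] C p_le[OF k(1)] in auto)
  then show "a \<in> active N" using C(1) k(2) unfolding active_def by (metis image_eqI)
qed

lemma F_eq:
  assumes C0: "\<And>C. C \<in> positive_circuits N \<Longrightarrow> C \<subseteq> F 0" and k: "k \<in> {1..n}"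
  shows "\<Union> {C \<in> positive_circuits N. p k \<le> Min C} = F (k - 1)"
proof (intro equalityI subsetI)
  fix x assume "x \<in> \<Union> {C \<in> positive_circuits N. p k \<le> Min C}"
  then obtain C where C: "C \<in> positive_circuits N" "p k \<le> Min C" "x \<in> C" by blast
  obtain j where j: "j \<in> {1..n}" "Min C = p j" "C \<subseteq> F (j - 1)"
    using positive_circuit_Min[OF C(1) C0[OF C(1)]] .
  have "k \<le> j"
  proof (rule ccontr)
    assume "\<not> k \<le> j"
    then have "p j < p k" using p_mono j(1) k by (auto simp: strict_mono_on_def)
    then show False using C(2) j(2) by simp
  qed
  then have "k - 1 \<le> j - 1" "j - 1 \<le> n" using j(1) by auto
  then show "x \<in> F (k - 1)" using antimono j(3) C(3) by blast
next
  fix x assume "x \<in> F (k - 1)"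
  moreover have "k - 1 \<le> n" using k by auto
  ultimately obtain C where C: "C \<in> positive_circuits N" "x \<in> C" "C \<subseteq> F (k - 1)"
    using positive_circuit_through by blast
  have "p k \<le> Min C"
    using p_le[OF k] C(3) positive_circuit[OF N C(1)] by (metis Min_in subsetD)
  then show "x \<in> \<Union> {C \<in> positive_circuits N. p k \<le> Min C}" using C by blast
qed

end

section \<open>From indexed chains to the lists in the active filtration\<close>

lemma sorted_list_of_set_strict_mono_image:
  fixes p :: "nat \<Rightarrow> 'a::linorder"
  assumes "strict_mono_on {1..n} p"
  shows "sorted_list_of_set (p ` {1..n}) = map p [1..<Suc n]"
proof -
  have "sorted_wrt (<) (map p [1..<Suc n])"
    using assms by (auto simp: sorted_wrt_iff_nth_less strict_mono_on_def simp del: upt_Suc)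
  moreover have "set (map p [1..<Suc n]) = p ` {1..n}" by auto
  ultimately show ?thesis
    using sorted_list_of_set.idem_if_sorted_distinct[of "map p [1..<Suc n]"]
    by (simp add: strict_sorted_iff del: upt_Suc)
qed

text \<open>The shape of both lists in \<open>active_filtration\<close>: the activity with index
  \<open>k\<close> produces the entry at position \<open>k - 1\<close>, and the appended
  \<open>z\<close> is the entry at position \<open>n\<close>.\<close>

lemma map_sorted_list_snoc_eq:
  fixes p :: "nat \<Rightarrow> 'a::linorder"
  assumes "strict_mono_on {1..n} p" "length L = Suc n" "L ! n = z"
    and "\<And>k. k \<in> {1..n} \<Longrightarrow> g (p k) = L ! (k - 1)"
  shows "map g (sorted_list_of_set (p ` {1..n})) @ [z] = L"
  unfolding sorted_list_of_set_strict_mono_image[OF assms(1)]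
proof (rule nth_equalityI)
  show "length (map g (map p [1..<Suc n]) @ [z]) = length L"
    using assms(2) by (simp del: upt_Suc)
  fix i assume "i < length (map g (map p [1..<Suc n]) @ [z])"
  then have "i < n \<or> i = n" by (auto simp del: upt_Suc)
  then show "(map g (map p [1..<Suc n]) @ [z]) ! i = L ! i"
    using assms(3) assms(4)[of "Suc i"] by (auto simp: nth_append simp del: upt_Suc)
qed

lemma active_filtration_unique:
  fixes N :: "'a::linorder omatroid"
  assumes N: "oriented_matroid N" and filt: "filtration N (F', Fc, F)"
    and b: "\<And>k. 1 \<le> k \<Longrightarrow> k \<le> length F - 1 \<Longrightarrow>
      bounded_wrt (minor N (F ! k) (F ! (k - 1))) (Min (F ! k - F ! (k - 1)))"
    and db: "\<And>k. 1 \<le> k \<Longrightarrow> k \<le> length F' - 1 \<Longrightarrow>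
      dual_bounded_wrt (minor N (F' ! (k - 1)) (F' ! k)) (Min (F' ! (k - 1) - F' ! k))"
  shows "active_filtration N = (F', Fc, F)"
proof -
  let ?n = "length F - 1" and ?m = "length F' - 1"
  let ?p = "\<lambda>k. Min (F ! k - F ! (k - 1))" and ?q = "\<lambda>k. Min (F' ! (k - 1) - F' ! k)"
  have f: "F' \<noteq> []" "F \<noteq> []" "F' ! ?m = {}" "F' ! 0 = Fc" "Fc = F ! 0" "F ! ?n = ground N"
    "\<And>k. 1 \<le> k \<Longrightarrow> k \<le> ?m \<Longrightarrow> F' ! k \<subset> F' ! (k - 1)"
    "\<And>k. 1 \<le> k \<Longrightarrow> k \<le> ?n \<Longrightarrow> F ! (k - 1) \<subset> F ! k"
    "\<And>k l. 1 \<le> k \<Longrightarrow> k < l \<Longrightarrow> l \<le> ?n \<Longrightarrow> ?p k < ?p l"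
    "\<And>k l. 1 \<le> k \<Longrightarrow> k < l \<Longrightarrow> l \<le> ?m \<Longrightarrow> ?q k < ?q l"
    using filt by (simp_all add: filtration_def)
  interpret B: bounded_chain N "\<lambda>k. F ! k" ?n ?p
    by unfold_locales (use N f(6,8,9) b in \<open>auto simp: strict_mono_on_def\<close>)
  interpret D: dual_bounded_chain N "\<lambda>k. F' ! k" ?m ?q
    by unfold_locales
      (use N f(3-5,7,10) db B.mono[of 0 ?n] B.top in \<open>auto simp: strict_mono_on_def\<close>)
  \<comment> \<open>Here the halves meet in the common set with index 0: the acyclic half bounds the
    positive circuits for the cyclic one, and the cyclic half keeps the positive cocircuits away for
    the acyclic one.\<close>
  have C0: "C \<subseteq> F' ! 0" if "C \<in> positive_circuits N" for C
    using B.positive_circuit_bottom[OF that] f(4,5) by simp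
  have D0: "D \<inter> F ! 0 = {}" if "D \<in> positive_cocircuits N" for D
    using D.positive_cocircuit_disjoint[OF that] f(4,5) by simp
  have len: "length F' = Suc ?m" "length F = Suc ?n" using f(1,2) by simp_all
  have "\<Union> (positive_circuits N) = Fc"
    using C0 D.positive_circuit_through[of 0] f(4) by auto
  moreover have "map (\<lambda>a'. \<Union> {C \<in> positive_circuits N. a' \<le> Min C}) (sorted_list_of_set (active N)) @ [{}] = F'"
  proof (subst D.active_eq[OF C0])
    show "map (\<lambda>a'. \<Union> {C \<in> positive_circuits N. a' \<le> Min C}) (sorted_list_of_set (?q ` {1..?m})) @ [{}] = F'"
      by (rule map_sorted_list_snoc_eq[OF D.p_mono len(1) f(3)]) (rule D.F_eq[OF C0])
  qed
  moreover have "map (\<lambda>a. ground N - \<Union> {D \<in> positive_cocircuits N. a \<le> Min D})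
      (sorted_list_of_set (dual_active N)) @ [ground N] = F"
  proof (subst B.dual_active_eq[OF D0])
    show "map (\<lambda>a. ground N - \<Union> {D \<in> positive_cocircuits N. a \<le> Min D})
        (sorted_list_of_set (?p ` {1..?n})) @ [ground N] = F"
      by (rule map_sorted_list_snoc_eq[OF B.p_mono len(2) f(6)]) (rule B.F_eq[OF D0])
  qed
  ultimately show ?thesis unfolding active_filtration_def by simp
qed

subsection \<open>The active filtration is a connected filtration\<close>

text \<open>Passes between the strict condition used for a single minor and the next activity used
  in the filtration: no value of \<open>f\<close> lies strictly between consecutive list entries.
  After the last entry the family is empty, which accounts for the appended final sets.\<close>

lemma Min_ge_sorted_list:
  fixes S :: "'a set set" and f :: "'a set \<Rightarrow> 'b::linorder"
  assumes "finite (f ` S)" and xs: "xs = sorted_list_of_set (f ` S)" and i: "i < length xs"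
  shows "{C \<in> S. xs ! i < f C} = (if Suc i < length xs then {C \<in> S. xs ! Suc i \<le> f C} else {})"
proof -
  have mono: "xs ! j < xs ! k \<longleftrightarrow> j < k" if "j < length xs" "k < length xs" for j k
    using that strict_sorted_list_of_set[of "f ` S"] unfolding xs
    by (metis not_less_iff_gr_or_eq sorted_wrt_nth_less)
  have ex: "\<exists>j<length xs. f C = xs ! j" if "C \<in> S" for C
    using assms(1) that unfolding xs by (metis image_eqI in_set_conv_nth set_sorted_list_of_set)
  show ?thesis
  proof (cases "Suc i < length xs")
    case True
    have "xs ! i < f C \<longleftrightarrow> xs ! Suc i \<le> f C" if C: "C \<in> S" for C
    proof -
      obtain j where j: "j < length xs" "f C = xs ! j" using ex[OF C] by blast
      have "xs ! Suc i \<le> xs ! j \<longleftrightarrow> \<not> j < Suc i" using mono[OF j(1) True] by (metis not_less)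
      then show ?thesis using mono[OF i j(1)] j(2) by auto
    qed
    then show ?thesis using True by auto
  next
    case False
    have "\<not> xs ! i < f C" if C: "C \<in> S" for C
      using ex[OF C] mono[OF i] False by auto
    then show ?thesis using False by auto
  qed
qed

lemma active_filtration_connected:
  fixes N :: "'a::linorder omatroid"
  assumes N: "oriented_matroid N" and af: "active_filtration N = (F', Fc, F)"
  shows "connected_filtration N (F', Fc, F)"
    and "1 \<le> k \<Longrightarrow> k \<le> length F - 1 \<Longrightarrow>
      bounded_wrt (minor N (F ! k) (F ! (k - 1))) (Min (F ! k - F ! (k - 1)))"
    and "1 \<le> k \<Longrightarrow> k \<le> length F' - 1 \<Longrightarrow>
      dual_bounded_wrt (minor N (F' ! (k - 1)) (F' ! k)) (Min (F' ! (k - 1) - F' ! k))"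
proof -
  let ?C = "positive_circuits N" and ?D = "positive_cocircuits N"
  define xs ys where "xs = sorted_list_of_set (dual_active N)" and "ys = sorted_list_of_set (active N)"
  have finC: "finite ?C" and finD: "finite ?D"
    using positive_circuit(1)[OF N] positive_cocircuit(1)[OF N] om_finite[OF N]
    by (auto intro!: finite_subset[of _ "Pow (ground N)"])
  then have fin: "finite (dual_active N)" "finite (active N)"
    by (simp_all add: dual_active_def active_def)
  have F: "F = map (\<lambda>a. ground N - \<Union> {D \<in> ?D. a \<le> Min D}) xs @ [ground N]"
    and F': "F' = map (\<lambda>a'. \<Union> {C \<in> ?C. a' \<le> Min C}) ys @ [{}]"
    and Fc: "Fc = \<Union> ?C"
    using af by (simp_all add: active_filtration_def xs_def ys_def)
  have len: "length F - 1 = length xs" "length F' - 1 = length ys" using F F' by simp_all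
  have xs_in: "xs ! i \<in> dual_active N" if "i < length xs" for i
    using that fin(1) nth_mem unfolding xs_def by (metis set_sorted_list_of_set)
  have ys_in: "ys ! i \<in> active N" if "i < length ys" for i
    using that fin(2) nth_mem unfolding ys_def by (metis set_sorted_list_of_set)
  have F_nth: "F ! i = ground N - \<Union> {D \<in> ?D. xs ! i \<le> Min D}" if "i < length xs" for i
    using that by (simp add: F nth_append)
  have F'_nth: "F' ! i = \<Union> {C \<in> ?C. ys ! i \<le> Min C}" if "i < length ys" for i
    using that by (simp add: F' nth_append)
  have F_Suc: "F ! Suc i = ground N - \<Union> {D \<in> ?D. xs ! i < Min D}" if "i < length xs" for i
    using that Min_ge_sorted_list[OF _ xs_def[unfolded dual_active_def] that] fin(1)
    by (auto simp: F nth_append dual_active_def)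
  have F'_Suc: "F' ! Suc i = \<Union> {C \<in> ?C. ys ! i < Min C}" if "i < length ys" for i
    using that Min_ge_sorted_list[OF _ ys_def[unfolded active_def] that] fin(2)
    by (auto simp: F' nth_append active_def)
  have b: "F ! i \<subset> F ! Suc i" "Min (F ! Suc i - F ! i) = xs ! i"
      "bounded_wrt (minor N (F ! Suc i) (F ! i)) (xs ! i)" if "i < length xs" for i
    using active_minor_bounded[OF N xs_in[OF that]] unfolding F_nth[OF that] F_Suc[OF that] by blast+
  have d: "F' ! Suc i \<subset> F' ! i" "Min (F' ! i - F' ! Suc i) = ys ! i"
      "dual_bounded_wrt (minor N (F' ! i) (F' ! Suc i)) (ys ! i)" if "i < length ys" for i
    using active_minor_dual_bounded[OF N ys_in[OF that]] unfolding F'_nth[OF that] F'_Suc[OF that]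
    by blast+
  have bk: "F ! (k - 1) \<subset> F ! k" "Min (F ! k - F ! (k - 1)) = xs ! (k - 1)"
      "bounded_wrt (minor N (F ! k) (F ! (k - 1))) (xs ! (k - 1))"
    if "1 \<le> k" "k \<le> length xs" for k
    using b[of "k - 1"] that by simp_all
  have dk: "F' ! k \<subset> F' ! (k - 1)" "Min (F' ! (k - 1) - F' ! k) = ys ! (k - 1)"
      "dual_bounded_wrt (minor N (F' ! (k - 1)) (F' ! k)) (ys ! (k - 1))"
    if "1 \<le> k" "k \<le> length ys" for k
    using d[of "k - 1"] that by simp_all
  show "bounded_wrt (minor N (F ! k) (F ! (k - 1))) (Min (F ! k - F ! (k - 1)))"
    if "1 \<le> k" "k \<le> length F - 1" for k
    using bk that len by simp
  show "dual_bounded_wrt (minor N (F' ! (k - 1)) (F' ! k)) (Min (F' ! (k - 1) - F' ! k))"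
    if "1 \<le> k" "k \<le> length F' - 1" for k
    using dk that len by simp
  have F_sub: "F ! k \<subseteq> ground N" if "k \<le> length xs" for k
    using that by (auto simp: F nth_append)
  have F'_sub: "F' ! k \<subseteq> ground N" if "k \<le> length ys" for k
  proof (cases "k < length ys")
    case True
    then show ?thesis using F'_nth positive_circuit(1)[OF N] by blast
  next
    case False
    then show ?thesis using that by (simp add: F' nth_append)
  qed
  have P: "oriented_matroid (minor N (F ! j) (F ! k))" if "k \<le> length xs" for j k
    using om_minor[OF N] F_sub[OF that] om_finite[OF N] by (meson finite_subset)
  have P': "oriented_matroid (minor N (F' ! j) (F' ! k))" if "k \<le> length ys" for j k
    using om_minor[OF N] F'_sub[OF that] om_finite[OF N] by (meson finite_subset)
  have disj: "C \<inter> D = {}" if "C \<in> ?C" "D \<in> ?D" for C D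
    using positive_cocircuit_orth[OF that(2), of "(C, {})"] that(1)
    by (simp add: positive_circuits_iff supp_def)
  have cover: "x \<in> \<Union> ?C \<or> x \<in> \<Union> ?D" if "x \<in> ground N" for x
  proof -
    have "\<exists>C\<in>?C. x \<in> C" if Z: "Z \<in> circuits N" "x \<in> fst Z" "snd Z \<subseteq> {}" for Z
    proof -
      have "Z = (fst Z, {})" using Z(3) by (simp add: prod_eq_iff)
      then have "fst Z \<in> ?C" using Z(1) positive_circuits_iff by metis
      then show ?thesis using Z(2) by blast
    qed
    then show ?thesis using farkas_contract[OF N empty_subsetI that] by blast
  qed
  \<comment> \<open>By Farkas every element lies on a positive circuit or a positive cocircuit, and
    by orthogonality never on both. This is why the two lists start at the same set.\<close>
  have Fc': "Fc = ground N - \<Union> ?D"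
    unfolding Fc using positive_circuit(1)[OF N] disj cover by blast
  have F0: "F ! 0 = Fc"
  proof (cases xs)
    case Nil
    then have "?D = {}" using fin(1) unfolding xs_def dual_active_def by simp
    then show ?thesis using Nil Fc' by (simp add: F)
  next
    case (Cons a as)
    \<comment> \<open>The first activity is the least one, so its bound selects every positive
      cocircuit.\<close>
    then have "a \<le> Min D" if "D \<in> ?D" for D
      using that fin(1) sorted_sorted_list_of_set[of "dual_active N"]
        set_sorted_list_of_set[OF fin(1)] unfolding xs_def[symmetric]
      by (auto simp: dual_active_def)
    then have "{D \<in> ?D. a \<le> Min D} = ?D" by blast
    then show ?thesis using Fc' Cons by (simp add: F)
  qed
  have F'0: "F' ! 0 = Fc"
  proof (cases ys)
    case Nil
    then have "?C = {}" using fin(2) unfolding ys_def active_def by simp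
    then show ?thesis using Nil Fc by (simp add: F')
  next
    case (Cons a as)
    then have "a \<le> Min C" if "C \<in> ?C" for C
      using that fin(2) sorted_sorted_list_of_set[of "active N"]
        set_sorted_list_of_set[OF fin(2)] unfolding ys_def[symmetric]
      by (auto simp: active_def)
    then have "{C \<in> ?C. a \<le> Min C} = ?C" by blast
    then show ?thesis using Fc Cons by (simp add: F')
  qed
  have mono: "xs ! (k - 1) < xs ! (l - 1)" if "1 \<le> k" "k < l" "l \<le> length xs" for k l
    using that sorted_wrt_nth_less[OF strict_sorted_list_of_set[of "dual_active N"]]
    unfolding xs_def by simp
  have mono': "ys ! (k - 1) < ys ! (l - 1)" if "1 \<le> k" "k < l" "l \<le> length ys" for k l
    using that sorted_wrt_nth_less[OF strict_sorted_list_of_set[of "active N"]]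
    unfolding ys_def by simp
  have "F \<noteq> []" "F' \<noteq> []" "F ! length xs = ground N" "F' ! length ys = {}"
    by (simp_all add: F F' nth_append)
  then have "filtration N (F', Fc, F)"
    unfolding filtration_def case_prod_conv len
    using F0 F'0 bk(1,2) dk(1,2) mono mono' by auto
  moreover have "matroid_connected (minor N (F ! k) (F ! (k - 1)))"
      "\<not> is_loop (minor N (F ! k) (F ! (k - 1)))" if "1 \<le> k" "k \<le> length xs" for k
    using bounded_connected[OF P bk(3)[OF that]] that by simp_all
  moreover have "matroid_connected (minor N (F' ! (k - 1)) (F' ! k))"
      "\<not> is_isthmus (minor N (F' ! (k - 1)) (F' ! k))" if "1 \<le> k" "k \<le> length ys" for k
    using dual_bounded_connected[OF P' dk(3)[OF that]] that by simp_all
  ultimately show "connected_filtration N (F', Fc, F)"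
    unfolding connected_filtration_def case_prod_conv len by simp
qed

subsection \<open>Reorientation\<close>

lemma supp_sign_switch [simp]: "supp (sign_switch A X) = supp X"
  by (auto simp: supp_def sign_switch_def)

lemma sign_switch_opposite: "sign_switch A (opposite X) = opposite (sign_switch A X)"
  by (simp add: sign_switch_def opposite_def)

lemma om_reorient:
  assumes M: "oriented_matroid M"
  shows "oriented_matroid (reorient A M)"
  unfolding oriented_matroid_def
proof (intro conjI ballI allI impI)
  let ?N = "reorient A M"
  show "finite (ground ?N)" using om_finite[OF M] by (simp add: reorient_def)
  fix X' assume "X' \<in> circuits ?N"
  then obtain X where X: "X \<in> circuits M" "X' = sign_switch A X" by (auto simp: reorient_def)
  note cX = om_circuit[OF M X(1)]
  show "supp X' \<noteq> {}" using cX(3) X(2) by simp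
  have "fst X' \<inter> snd X' = {}" using cX(1) X(2) by (auto simp: sign_switch_def)
  then show "signed_subset X' (ground ?N)"
    using cX(2) X(2) by (simp add: signed_subset_def reorient_def)
  show "opposite X' \<in> circuits ?N"
    using om_opposite[OF M X(1)] X(2) by (simp add: reorient_def sign_switch_opposite[symmetric])
  fix Y' assume "Y' \<in> circuits ?N"
  then obtain Y where Y: "Y \<in> circuits M" "Y' = sign_switch A Y" by (auto simp: reorient_def)
  show "X' = Y' \<or> X' = opposite Y'" if "supp X' \<subseteq> supp Y'"
    using om_incomparable[OF M X(1) Y(1)] that X(2) Y(2) by (auto simp: sign_switch_opposite)
  fix e assume e: "X' \<noteq> opposite Y' \<and> e \<in> fst X' \<inter> snd Y'"
  then have ne: "X \<noteq> opposite Y" "Y \<noteq> opposite X"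
    using X(2) Y(2) by (auto simp: sign_switch_opposite)
  have "\<exists>Z\<in>circuits M. fst Z \<subseteq> fst X \<union> fst Y - {e} \<and> snd Z \<subseteq> snd X \<union> snd Y - {e}"
  proof (cases "e \<in> A")
    \<comment> \<open>Switching the sign at \<open>e\<close> exchanges the roles of \<open>X\<close>
      and \<open>Y\<close> in the elimination.\<close>
    case True
    then have "e \<in> fst Y" "e \<in> snd X" using e X(2) Y(2) by (auto simp: sign_switch_def)
    then show ?thesis using om_elim[OF M Y(1) X(1) ne(2)] by (metis Un_commute)
  next
    case False
    then have "e \<in> fst X" "e \<in> snd Y" using e X(2) Y(2) by (auto simp: sign_switch_def)
    then show ?thesis using om_elim[OF M X(1) Y(1) ne(1)] by metis
  qed
  then obtain Z where Z: "Z \<in> circuits M" "fst Z \<subseteq> fst X \<union> fst Y - {e}"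
      "snd Z \<subseteq> snd X \<union> snd Y - {e}" by blast
  have "sign_switch A Z \<in> circuits ?N" using Z(1) by (simp add: reorient_def)
  moreover have "fst (sign_switch A Z) \<subseteq> fst X' \<union> fst Y' - {e}"
    "snd (sign_switch A Z) \<subseteq> snd X' \<union> snd Y' - {e}"
    using Z(2,3) unfolding X(2) Y(2) sign_switch_def fst_conv snd_conv by blast+
  ultimately show "\<exists>Z\<in>circuits ?N. fst Z \<subseteq> fst X' \<union> fst Y' - {e} \<and> snd Z \<subseteq> snd X' \<union> snd Y' - {e}"
    by blast
qed

text \<open>The right-hand side involves unsigned circuits only, so minors of a reorientation have
  the same underlying matroids as minors of \<open>M\<close>.\<close>

lemma matroid_circuits_contract:
  "matroid_circuits (om_contract M F) =
    {C \<in> (\<lambda>C. C - F) ` matroid_circuits M. C \<noteq> {} \<and>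
      (\<forall>C'\<in>matroid_circuits M. C' - F \<noteq> {} \<longrightarrow> \<not> C' - F \<subset> C)}" (is "?L = ?R")
proof (intro equalityI subsetI)
  fix C assume "C \<in> ?L"
  then obtain X where X: "X \<in> circuits (om_contract M F)" "supp X = C"
    unfolding matroid_circuits_iff by blast
  obtain Z where "Z \<in> circuits M" "supp X = supp Z - F" "supp X \<noteq> {}"
    using contract_circuitE[OF X(1)] by metis
  then show "C \<in> ?R"
    using contract_circuit_minimal[OF X(1)] X(2) by (auto simp: matroid_circuits_def)
next
  fix C assume "C \<in> ?R"
  then have C: "C \<in> (\<lambda>C. C - F) ` matroid_circuits M" "C \<noteq> {}"
      "\<forall>C'\<in>matroid_circuits M. C' - F \<noteq> {} \<longrightarrow> \<not> C' - F \<subset> C"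
    by simp_all
  obtain Z where Z: "Z \<in> circuits M" "C = supp Z - F"
    using C(1) unfolding matroid_circuits_def by blast
  have min: "\<not> supp W - F \<subset> C" if "W \<in> circuits M" "supp W - F \<noteq> {}" for W
    using C(3) that unfolding matroid_circuits_def by simp
  have "(fst Z - F, snd Z - F) \<in> circuits (om_contract M F)"
    by (rule contract_circuitI) (use Z C(2) min in auto)
  then show "C \<in> ?L" using Z(2) unfolding matroid_circuits_iff by (metis supp_trace)
qed

lemma matroid_circuits_restrict:
  "matroid_circuits (om_restrict M F) = {C \<in> matroid_circuits M. C \<subseteq> F}"
  by (auto simp: matroid_circuits_def om_restrict_def)

lemma matroid_circuits_reorient: "matroid_circuits (reorient A M) = matroid_circuits M"
  by (simp add: matroid_circuits_def reorient_def image_image)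

lemma connected_filtration_reorient:
  "connected_filtration (reorient A M) \<F> \<longleftrightarrow> connected_filtration M \<F>"
proof -
  let ?N = "reorient A M"
  have g: "ground ?N = ground M" by (simp add: reorient_def)
  have gm: "ground (minor ?N F G) = ground (minor M F G)" for F G by (simp add: g)
  have mc: "matroid_circuits (minor ?N F G) = matroid_circuits (minor M F G)" for F G
    by (simp add: matroid_circuits_contract matroid_circuits_restrict matroid_circuits_reorient)
  have "matroid_cocircuits (minor ?N F G) = matroid_cocircuits (minor M F G)" for F G
    unfolding matroid_cocircuits_def codependent_def matroid_bases_def independent_def mc gm ..
  then show ?thesis
    unfolding connected_filtration_def filtration_def matroid_connected_def is_loop_def is_isthmus_def
      mc gm g by simp
qed

theorem theorem4p6:
  fixes M :: "'a::linorder omatroid"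
  assumes "oriented_matroid M"
  shows "reorientations M = (\<Union>\<F> \<in> {\<F>. connected_filtration M \<F>}. filtration_class M \<F>)
    \<and> disjoint_family_on (filtration_class M) {\<F>. connected_filtration M \<F>}
    \<and> (\<forall>A N \<F>. connected_filtration M \<F> \<and> (A, N) \<in> filtration_class M \<F>
         \<longrightarrow> \<F> = active_filtration N)"
proof (intro conjI)
  \<comment> \<open>Since the right-hand side depends on \<open>N\<close> alone, a reorientation
    lying in two classes makes their filtrations equal, so disjointness follows as well.\<close>
  have unique: "\<F> = active_filtration N"
    if \<F>: "connected_filtration M \<F>" "(A, N) \<in> filtration_class M \<F>" for A N \<F>
  proof -
    obtain F' Fc F where eq: "\<F> = (F', Fc, F)" by (metis prod.exhaust)
    have N: "N = reorient A M" using \<F>(2) by (auto simp: filtration_class_def reorientations_def)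
    have "connected_filtration N \<F>" using \<F>(1) by (simp add: N connected_filtration_reorient)
    then have "filtration N \<F>" by (simp add: connected_filtration_def)
    then show ?thesis
      using active_filtration_unique[of N F' Fc F] om_reorient[OF assms] \<F>(2)
      unfolding eq N filtration_class_def by simp
  qed
  then show "\<forall>A N \<F>. connected_filtration M \<F> \<and> (A, N) \<in> filtration_class M \<F>
      \<longrightarrow> \<F> = active_filtration N" by blast
  show "disjoint_family_on (filtration_class M) {\<F>. connected_filtration M \<F>}"
    unfolding disjoint_family_on_def
  proof (intro ballI impI equals0I)
    fix \<F> \<G> R
    assume fg: "\<F> \<in> {\<F>. connected_filtration M \<F>}" "\<G> \<in> {\<F>. connected_filtration M \<F>}" "\<F> \<noteq> \<G>"
      and R: "R \<in> filtration_class M \<F> \<inter> filtration_class M \<G>"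
    then show False using unique[of \<F> "fst R" "snd R"] unique[of \<G> "fst R" "snd R"] by simp
  qed
  show "reorientations M = (\<Union>\<F> \<in> {\<F>. connected_filtration M \<F>}. filtration_class M \<F>)"
  proof (intro equalityI subsetI)
    fix R assume R: "R \<in> reorientations M"
    then obtain A where A: "R = (A, reorient A M)" by (auto simp: reorientations_def)
    let ?N = "reorient A M"
    obtain F' Fc F where af: "active_filtration ?N = (F', Fc, F)" by (metis prod.exhaust)
    note N = om_reorient[OF assms, of A]
    have "connected_filtration M (F', Fc, F)"
      using active_filtration_connected(1)[OF N af] connected_filtration_reorient by blast
    moreover have "R \<in> filtration_class M (F', Fc, F)"
      using R active_filtration_connected(2,3)[OF N af] unfolding filtration_class_def A by simp
    ultimately show "R \<in> (\<Union>\<F> \<in> {\<F>. connected_filtration M \<F>}. filtration_class M \<F>)" by blast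
  qed (auto simp: filtration_class_def)
qed

end
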